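(* Let $L\in\mathrm{Lin}\,\mathbb H$ be symmetric and Hermitian, and suppose that $\psi\in\bar{\mathbb H}\setminus\{0\}$ satisfies $\bar\psi=\psi$ and $L\psi\in\bar{\mathbb H}$. Put $$\widehat L=\Big(1-\frac{\psi\psi^T}{\psi^T\psi}\Big)L\Big(1-\frac{\psi\psi^T}{\psi^T\psi}\Big),\qquad \tau_L(\psi):=2\,\frac{(L\psi)^T(L\psi)}{\psi^T\psi}-\Big(\frac{\psi^TL\psi}{\psi^T\psi}\Big)^2 .$$ (i) Any symmetric and Hermitian $\widetilde L\in\mathrm{Lin}\,\mathbb H$ with $\widetilde L\psi=0$ satisfies $$\mathrm{tr}(\widetilde L-L)^2\ge\tau_L(\psi).$$ Equality is achieved precisely when $\widetilde L=\widehat L$. (ii) We always have $$0\le\frac{(L\psi)^TL\psi}{\psi^T\psi}\le\tau_L(\psi)\le2\,\frac{(L\psi)^TL\psi}{\psi^T\psi}.$$ In particular, $\tau_L(\psi)=0$ if and only if $L\psi=0$.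
   Context: $\mathbb H$ is a complex topological vector space with a complex conjugation $\varphi\mapsto\bar\varphi$ and a continuous symmetric bilinear form $\varphi^T\psi$, compatible with conjugation and definite in the sense that $\varphi^*\psi:=\bar\varphi^T\psi$ is a positive definite Hermitian inner product, with norm $\|\psi\|=\sqrt{\psi^*\psi}$. $\mathbb H^*$ is the continuous dual with pairing $\varphi^T\psi=\psi^T\varphi$ ($\varphi\in\mathbb H,\psi\in\mathbb H^*$); the form embeds $\mathbb H$ into $\mathbb H^*$. $\bar{\mathbb H}$ is the closure of $\mathbb H$ in $\mathbb H^*$ with respect to the Euclidean norm, a Hilbert space with $\mathbb H\subseteq\bar{\mathbb H}\subseteq\mathbb H^*$, to which the bilinear form, the inner product and conjugation extend by continuity. $\mathrm{Lin}\,\mathbb H$ is the algebra of continuous linear maps $\mathbb H\to\mathbb H$. $A\in\mathrm{Lin}\,\mathbb H$ is symmetric if $(A\varphi)^T\psi=\varphi^TA\psi$ for $\varphi,\psi\in\mathbb H$, and Hermitian if $A^*=A$ on $\mathbb H$, where $A^*=\bar A^T$. A symmetric $A$ is extended to $\mathbb H^*$ by $\varphi^TA\psi=(A\varphi)^T\psi$ for $\varphi\in\mathbb H,\psi\in\mathbb H^*$. For $\alpha,\beta\in\bar{\mathbb H}$, $\alpha\beta^T$ is the rank-one operator $\chi\mapsto\alpha(\beta^T\chi)$. The trace of the square of a Hermitian operator is its Hilbert space trace on $\bar{\mathbb H}$, taken as $+\infty$ if the square is not trace class. *)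

theory Defs
  imports "HOL-Analysis.Analysis" "HOL-Library.Complex_Order"
begin

text \<open>
  The space \<open>\<bbbH>\<close> is a type \<open>'h\<close> of the class below; \<open>hconj \<phi>\<close> is the conjugate of \<open>\<phi>\<close> and
  \<open>bform \<phi> \<psi>\<close> is \<open>\<phi>\<^sup>T\<psi>\<close>. Additivity and homogeneity of \<open>bform\<close> in the second argument
  follow by symmetry, as does the fact that \<open>bform (hconj x) x\<close> is real. The topology is
  Hausdorff because the Euclidean norm is continuous.
\<close>

class euclidean_tvs = topological_ab_group_add +
  fixes scaleC :: "complex \<Rightarrow> 'a \<Rightarrow> 'a"
    and hconj :: "'a \<Rightarrow> 'a"
    and bform :: "'a \<Rightarrow> 'a \<Rightarrow> complex"
  assumes scaleC_add_right: "scaleC a (x + y) = scaleC a x + scaleC a y"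
    and scaleC_add_left: "scaleC (a + b) x = scaleC a x + scaleC b x"
    and scaleC_scaleC: "scaleC a (scaleC b x) = scaleC (a * b) x"
    and scaleC_one: "scaleC 1 x = x"
    and tendsto_scaleC_Pair: "LIM p (nhds a \<times>\<^sub>F nhds x). scaleC (fst p) (snd p) :> nhds (scaleC a x)"
    and hconj_add: "hconj (x + y) = hconj x + hconj y"
    and hconj_scaleC: "hconj (scaleC a x) = scaleC (cnj a) (hconj x)"
    and hconj_hconj: "hconj (hconj x) = x"
    and tendsto_hconj_nhds: "LIM y (nhds x). hconj y :> nhds (hconj x)"
    and bform_sym: "bform x y = bform y x"
    and bform_add: "bform (x + y) z = bform x z + bform y z"
    and bform_scaleC: "bform (scaleC a x) y = a * bform x y"
    and tendsto_bform_Pair: "LIM p (nhds x \<times>\<^sub>F nhds y). bform (fst p) (snd p) :> nhds (bform x y)"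
    and bform_hconj: "bform (hconj x) (hconj y) = cnj (bform x y)"
    and bform_pos: "x \<noteq> 0 \<Longrightarrow> 0 < Re (bform (hconj x) x)"

definition hnorm :: "'h::euclidean_tvs \<Rightarrow> real" where
  "hnorm \<phi> = sqrt (Re (bform (hconj \<phi>) \<phi>))"

text \<open>
  An element \<open>f\<close> of the dual \<open>\<bbbH>\<^sup>*\<close> is the functional \<open>\<phi> \<mapsto> \<phi>\<^sup>T f = f\<^sup>T \<phi>\<close>; \<open>emb\<close> is the
  inclusion of \<open>\<bbbH>\<close> in \<open>\<bbbH>\<^sup>*\<close> given by the bilinear form.
\<close>

definition dual :: "('h::euclidean_tvs \<Rightarrow> complex) set" where
  "dual = {f. Vector_Spaces.linear scaleC (*) f \<and> continuous_on UNIV f}"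

definition emb :: "'h::euclidean_tvs \<Rightarrow> 'h \<Rightarrow> complex" where
  "emb \<phi> = (\<lambda>\<xi>. bform \<phi> \<xi>)"

text \<open>
  The Euclidean norm on \<open>\<bbbH>\<^sup>*\<close>, with value \<open>\<infinity>\<close> for functionals that are unbounded in the
  Euclidean norm of \<open>\<bbbH>\<close>. By Cauchy--Schwarz \<open>dual_norm (emb \<phi>) = hnorm \<phi>\<close>.
\<close>

definition dual_norm :: "('h::euclidean_tvs \<Rightarrow> complex) \<Rightarrow> ereal" where
  "dual_norm f = (SUP \<xi>\<in>{\<xi>. hnorm \<xi> \<le> 1}. ereal (cmod (f \<xi>)))"

text \<open>The closure of \<open>\<bbbH>\<close> in \<open>\<bbbH>\<^sup>*\<close> in the Euclidean norm.\<close>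

definition hbar :: "('h::euclidean_tvs \<Rightarrow> complex) set" where
  "hbar = {\<alpha> \<in> dual. \<forall>\<epsilon>>0. \<exists>\<phi>. dual_norm (\<lambda>\<xi>. \<alpha> \<xi> - emb \<phi> \<xi>) < ereal \<epsilon>}"

text \<open>
  The filter on \<open>\<bbbH>\<close> of convergence \<open>\<phi> \<rightarrow> \<alpha>\<close> in the Euclidean norm, for \<open>\<alpha>\<close> in \<open>hbar\<close>.
  Extensions by continuity are limits along it. A map into \<open>\<bbbH>\<close> that is uniformly continuous
  in the Euclidean norm is extended by \<open>map_bar\<close>; the limit exists in that norm, and its value
  at \<open>\<xi>\<close> is the limit of the values at \<open>\<xi>\<close>.
\<close>

definition approx :: "('h::euclidean_tvs \<Rightarrow> complex) \<Rightarrow> 'h filter" where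
  "approx \<alpha> = filtercomap (\<lambda>\<phi>. dual_norm (\<lambda>\<xi>. \<alpha> \<xi> - emb \<phi> \<xi>)) (nhds 0)"

definition bform_bar :: "('h::euclidean_tvs \<Rightarrow> complex) \<Rightarrow> ('h \<Rightarrow> complex) \<Rightarrow> complex" where
  "bform_bar \<alpha> \<beta> = Lim (approx \<alpha> \<times>\<^sub>F approx \<beta>) (\<lambda>(\<phi>, \<psi>). bform \<phi> \<psi>)"

definition inner_bar :: "('h::euclidean_tvs \<Rightarrow> complex) \<Rightarrow> ('h \<Rightarrow> complex) \<Rightarrow> complex" where
  "inner_bar \<alpha> \<beta> = Lim (approx \<alpha> \<times>\<^sub>F approx \<beta>) (\<lambda>(\<phi>, \<psi>). bform (hconj \<phi>) \<psi>)"

definition map_bar :: "('h::euclidean_tvs \<Rightarrow> 'h) \<Rightarrow> ('h \<Rightarrow> complex) \<Rightarrow> 'h \<Rightarrow> complex" where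
  "map_bar T \<alpha> = (\<lambda>\<xi>. Lim (approx \<alpha>) (\<lambda>\<phi>. emb (T \<phi>) \<xi>))"

definition hconj_bar :: "('h::euclidean_tvs \<Rightarrow> complex) \<Rightarrow> 'h \<Rightarrow> complex" where
  "hconj_bar = map_bar hconj"

definition Lin :: "('h::euclidean_tvs \<Rightarrow> 'h) set" where
  "Lin = {A. Vector_Spaces.linear scaleC scaleC A \<and> continuous_on UNIV A}"

definition symmetric_op :: "('h::euclidean_tvs \<Rightarrow> 'h) \<Rightarrow> bool" where
  "symmetric_op A \<longleftrightarrow> (\<forall>\<phi> \<psi>. bform (A \<phi>) \<psi> = bform \<phi> (A \<psi>))"

text \<open>
  The transpose \<open>A\<^sup>T : \<bbbH>\<^sup>* \<rightarrow> \<bbbH>\<^sup>*\<close>, \<open>\<phi>\<^sup>T A\<^sup>T f = (A \<phi>)\<^sup>T f\<close>. For symmetric \<open>A\<close> it is the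
  extension of \<open>A\<close> to \<open>\<bbbH>\<^sup>*\<close>.
\<close>

definition transpose_op :: "('h::euclidean_tvs \<Rightarrow> 'h) \<Rightarrow> ('h \<Rightarrow> complex) \<Rightarrow> 'h \<Rightarrow> complex" where
  "transpose_op A f = (\<lambda>\<phi>. f (A \<phi>))"

definition conj_op :: "('h::euclidean_tvs \<Rightarrow> 'h) \<Rightarrow> 'h \<Rightarrow> 'h" where
  "conj_op A = (\<lambda>\<phi>. hconj (A (hconj \<phi>)))"

definition adjoint_op :: "('h::euclidean_tvs \<Rightarrow> 'h) \<Rightarrow> ('h \<Rightarrow> complex) \<Rightarrow> 'h \<Rightarrow> complex" where
  "adjoint_op A = transpose_op (conj_op A)"

definition hermitian_op :: "('h::euclidean_tvs \<Rightarrow> 'h) \<Rightarrow> bool" where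
  "hermitian_op A \<longleftrightarrow> (\<forall>\<phi>. adjoint_op A (emb \<phi>) = emb (A \<phi>))"

definition onb :: "('h::euclidean_tvs \<Rightarrow> complex) set \<Rightarrow> bool" where
  "onb E \<longleftrightarrow> E \<subseteq> hbar \<and>
     (\<forall>e\<in>E. \<forall>f\<in>E. inner_bar e f = (if e = f then 1 else 0)) \<and>
     (\<forall>\<alpha>\<in>hbar. (\<forall>e\<in>E. inner_bar e \<alpha> = 0) \<longrightarrow> \<alpha> = (\<lambda>_. 0))"

text \<open>
  An operator on \<open>\<bbbH>\<close> is trace class if it is bounded in the Euclidean norm and its bounded
  extension to the Hilbert space \<open>hbar\<close> has absolutely summable diagonal in every orthonormal
  basis (for complex Hilbert spaces this is equivalent to \<open>\<bar>T\<bar>\<close> having finite trace; for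
  positive operators such as squares of Hermitian ones, \<open>\<bar>T\<bar> = T\<close>). The trace does not
  depend on the orthonormal basis chosen.
\<close>

definition trace_class :: "('h::euclidean_tvs \<Rightarrow> 'h) \<Rightarrow> bool" where
  "trace_class T \<longleftrightarrow> (\<exists>C. \<forall>\<phi>. hnorm (T \<phi>) \<le> C * hnorm \<phi>) \<and>
     (\<forall>E. onb E \<longrightarrow> (\<lambda>e. inner_bar e (map_bar T e)) summable_on E)"

definition hilbert_trace :: "('h::euclidean_tvs \<Rightarrow> 'h) \<Rightarrow> complex" where
  "hilbert_trace T = (let E = (SOME E. onb E) in \<Sum>\<^sub>\<infinity>e\<in>E. inner_bar e (map_bar T e))"

definition trace_square :: "('h::euclidean_tvs \<Rightarrow> 'h) \<Rightarrow> ereal" where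
  "trace_square A =
     (if trace_class (A \<circ> A) then ereal (Re (hilbert_trace (A \<circ> A))) else \<infinity>)"

definition rank_one ::
    "('h::euclidean_tvs \<Rightarrow> complex) \<Rightarrow> ('h \<Rightarrow> complex) \<Rightarrow> ('h \<Rightarrow> complex) \<Rightarrow> 'h \<Rightarrow> complex" where
  "rank_one \<alpha> \<beta> \<xi> = (\<lambda>\<phi>. bform_bar \<beta> \<xi> * \<alpha> \<phi>)"

text \<open>\<open>proj_compl \<psi>\<close> is \<open>1 - \<psi>\<psi>\<^sup>T / \<psi>\<^sup>T\<psi>\<close>.\<close>

definition proj_compl ::
    "('h::euclidean_tvs \<Rightarrow> complex) \<Rightarrow> ('h \<Rightarrow> complex) \<Rightarrow> 'h \<Rightarrow> complex" where
  "proj_compl \<psi> \<xi> = (\<lambda>\<phi>. \<xi> \<phi> - rank_one \<psi> \<psi> \<xi> \<phi> / bform_bar \<psi> \<psi>)"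

text \<open>
  If \<open>\<psi>\<close> and \<open>L \<psi>\<close> are in \<open>hbar\<close>, then \<open>L_hat L \<psi>\<close> maps \<open>\<bbbH>\<close> into \<open>hbar\<close>, but not
  necessarily into \<open>\<bbbH>\<close>.
\<close>

definition L_hat :: "('h::euclidean_tvs \<Rightarrow> 'h) \<Rightarrow> ('h \<Rightarrow> complex) \<Rightarrow> 'h \<Rightarrow> 'h \<Rightarrow> complex" where
  "L_hat L \<psi> \<phi> = proj_compl \<psi> (transpose_op L (proj_compl \<psi> (emb \<phi>)))"

definition tau :: "('h::euclidean_tvs \<Rightarrow> 'h) \<Rightarrow> ('h \<Rightarrow> complex) \<Rightarrow> complex" where
  "tau L \<psi> =
     2 * (bform_bar (transpose_op L \<psi>) (transpose_op L \<psi>) / bform_bar \<psi> \<psi>)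
     - (bform_bar \<psi> (transpose_op L \<psi>) / bform_bar \<psi> \<psi>)\<^sup>2"

end

theory Submission
  imports Defs
begin

text \<open>
  With \<open>B = Lt - L\<close> the condition \<open>Lt \<psi> = 0\<close> prescribes \<open>B \<psi> = - L \<psi>\<close>. Let \<open>u\<close> be the
  normalised \<open>\<psi>\<close>, \<open>v = B u\<close>, and \<open>P = 1 - u u\<^sup>*\<close>. Then \<open>B = K + P B P\<close>, where
  \<open>K = u v\<^sup>* + v u\<^sup>* - (u\<^sup>* v) u u\<^sup>*\<close> is determined by \<open>\<psi>\<close> and \<open>L \<psi>\<close>. The two summands are
  orthogonal in the Hilbert-Schmidt inner product, so \<open>tr B\<^sup>2\<close> is at least \<open>tr K\<^sup>2\<close>, which
  equals \<open>2 \<parallel>v\<parallel>\<^sup>2 - (u\<^sup>* v)\<^sup>2 = \<tau>\<close>, with equality iff \<open>P B P = 0\<close>, that is \<open>Lt = L_hat\<close>. Parseval's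
  identity in the orthonormal basis at hand suffices for this, and basis independence of the
  trace is never needed. The extension of \<open>B\<close> to the completion exists as soon as \<open>B\<^sup>2\<close> is bounded,
  since \<open>\<parallel>B \<phi>\<parallel>\<^sup>2 = \<phi>\<^sup>* B\<^sup>2 \<phi>\<close>. Part (ii) is the Cauchy-Schwarz inequality.
\<close>

section \<open>Complex Hilbert spaces\<close>

text \<open>Two instances are intended: the given space, in general incomplete, and its completion.
  The laws for \<open>cscale\<close> that are used later follow by testing against the definite
  form.\<close>

locale complex_inner_space =
  fixes cscale :: "complex \<Rightarrow> 'a::ab_group_add \<Rightarrow> 'a"
    and cinner :: "'a \<Rightarrow> 'a \<Rightarrow> complex"
  assumes cinner_add_right: "cinner x (y + z) = cinner x y + cinner x z"
    and cinner_cscale_right: "cinner x (cscale c y) = c * cinner x y"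
    and cinner_commute: "cinner x y = cnj (cinner y x)"
    and cinner_pos: "x \<noteq> 0 \<Longrightarrow> 0 < Re (cinner x x)"
begin

definition cnorm :: "'a \<Rightarrow> real" where
  "cnorm x = sqrt (Re (cinner x x))"

lemma cinner_add_left: "cinner (x + y) z = cinner x z + cinner y z"
  by (metis cinner_commute cinner_add_right complex_cnj_add)

lemma cinner_cscale_left: "cinner (cscale c x) y = cnj c * cinner x y"
  by (metis cinner_commute cinner_cscale_right complex_cnj_mult)

lemma cinner_zero_right [simp]: "cinner x 0 = 0"
  using cinner_add_right[of x 0 0] by simp

lemma cinner_zero_left [simp]: "cinner 0 x = 0"
  using cinner_add_left[of 0 0 x] by simp

lemma cinner_minus_right: "cinner x (- y) = - cinner x y"
  using cinner_add_right[of x y "- y"] by (simp add: eq_neg_iff_add_eq_0 add.commute)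

lemma cinner_minus_left: "cinner (- x) y = - cinner x y"
  using cinner_add_left[of x "- x" y] by (simp add: eq_neg_iff_add_eq_0 add.commute)

lemma cinner_diff_right: "cinner x (y - z) = cinner x y - cinner x z"
  using cinner_add_right[of x y "- z"] by (simp add: cinner_minus_right)

lemma cinner_diff_left: "cinner (x - y) z = cinner x z - cinner y z"
  using cinner_add_left[of x "- y" z] by (simp add: cinner_minus_left)

lemma cinner_sum_right: "cinner x (\<Sum>i\<in>I. f i) = (\<Sum>i\<in>I. cinner x (f i))"
  by (induction I rule: infinite_finite_induct) (simp_all add: cinner_add_right)

lemmas cinner_simps = cinner_add_left cinner_add_right cinner_diff_left cinner_diff_right
  cinner_cscale_left cinner_cscale_right cinner_minus_left cinner_minus_right

lemma Re_cinner_nonneg: "0 \<le> Re (cinner x x)"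
  by (cases "x = 0") (auto intro: less_imp_le cinner_pos)

lemma cnorm_nonneg [simp]: "0 \<le> cnorm x"
  by (simp add: cnorm_def Re_cinner_nonneg)

lemma cinner_self: "cinner x x = complex_of_real ((cnorm x)\<^sup>2)"
proof -
  have "Im (cinner x x) = 0"
    using arg_cong[OF cinner_commute[of x x], of Im] by simp
  then show ?thesis
    by (simp add: cnorm_def Re_cinner_nonneg complex_eq_iff)
qed

lemma cnorm_eq_0_iff [simp]: "cnorm x = 0 \<longleftrightarrow> x = 0"
  using cinner_pos[of x] by (cases "x = 0") (auto simp: cnorm_def)

lemma cnorm_cscale: "cnorm (cscale c x) = cmod c * cnorm x"
proof -
  have "complex_of_real ((cnorm (cscale c x))\<^sup>2) = complex_of_real ((cmod c * cnorm x)\<^sup>2)"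
    unfolding cinner_self[symmetric] power_mult_distrib of_real_mult complex_norm_square
    by (simp add: cinner_simps)
  then show ?thesis
    by (simp only: of_real_eq_iff) simp
qed

lemma Cauchy_Schwarz: "cmod (cinner x y) \<le> cnorm x * cnorm y"
proof (cases "x = 0")
  case False
  define n where "n = (cnorm x)\<^sup>2"
  have n: "n > 0"
    using False by (simp add: n_def)
  \<comment> \<open>With this choice \<open>cscale c x\<close> is the orthogonal projection of y to
    the line of x; the inequality says that the residual has nonnegative square.\<close>
  define c where "c = cinner x y / of_real n"
  have "cinner (y - cscale c x) (y - cscale c x)
      = cinner y y - c * cinner y x - cnj c * (cinner x y - c * of_real n)"
    by (simp add: cinner_simps cinner_self[of x] n_def algebra_simps)
  also have "c * of_real n = cinner x y"
    using n by (simp add: c_def)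
  also have "c * cinner y x = of_real ((cmod (cinner x y))\<^sup>2 / n)"
    unfolding of_real_divide complex_norm_square c_def by (subst (2) cinner_commute) simp
  finally have "Re (cinner (y - cscale c x) (y - cscale c x))
      = (cnorm y)\<^sup>2 - (cmod (cinner x y))\<^sup>2 / n"
    by (simp add: cinner_self[of y])
  then have "(cmod (cinner x y))\<^sup>2 / n \<le> (cnorm y)\<^sup>2"
    using Re_cinner_nonneg[of "y - cscale c x"] by linarith
  then have "(cmod (cinner x y))\<^sup>2 \<le> (cnorm x * cnorm y)\<^sup>2"
    using n by (simp add: n_def field_simps power_mult_distrib)
  then show ?thesis
    by (rule power2_le_imp_le) simp
qed simp

section \<open>Orthonormal families and Bessel's inequality\<close>

definition orthonormal :: "'a set \<Rightarrow> bool" where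
  "orthonormal E \<longleftrightarrow> (\<forall>e\<in>E. \<forall>f\<in>E. cinner e f = (if e = f then 1 else 0))"

text \<open>Totality is a trivial orthogonal complement, as in \<open>onb\<close>. Convergence of
  expansions is derived later, from completeness.\<close>

definition orthonormal_basis :: "'a set \<Rightarrow> bool" where
  "orthonormal_basis E \<longleftrightarrow> orthonormal E \<and> (\<forall>x. (\<forall>e\<in>E. cinner e x = 0) \<longrightarrow> x = 0)"

text \<open>Zorn's lemma gives a maximal orthonormal set; a nonzero vector orthogonal to it could be
  normalised and added.\<close>

lemma orthonormal_basis_exists: "\<exists>E. orthonormal_basis E"
proof -
  have "\<Union>C \<in> {E. orthonormal E}" if C: "subset.chain {E. orthonormal E} C" for C
  proof -
    have "cinner e f = (if e = f then 1 else 0)" if "X \<in> C" "Y \<in> C" "e \<in> X" "f \<in> Y" for e f X Y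
    proof -
      have "X \<subseteq> Y \<or> Y \<subseteq> X" "orthonormal X" "orthonormal Y"
        using C that unfolding subset.chain_def by blast+
      then show ?thesis
        using that unfolding orthonormal_def by blast
    qed
    then show ?thesis
      by (auto simp: orthonormal_def)
  qed
  then obtain M where M: "orthonormal M" "\<And>X. orthonormal X \<Longrightarrow> M \<subseteq> X \<Longrightarrow> X = M"
    using subset_Zorn'[of "{E. orthonormal E}"] by blast
  have "x = 0" if x: "\<forall>e\<in>M. cinner e x = 0" for x
  proof (rule ccontr)
    assume "x \<noteq> 0"
    define u where "u = cscale (of_real (inverse (cnorm x))) x"
    have u: "cinner u u = 1"
      using \<open>x \<noteq> 0\<close> by (simp add: u_def cinner_self cnorm_cscale norm_inverse)
    have eu: "cinner e u = 0" "cinner u e = 0" if "e \<in> M" for e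
      using x that cinner_commute[of u e] by (auto simp: u_def cinner_simps)
    have "orthonormal (insert u M)"
      using M(1) u eu by (auto simp: orthonormal_def)
    then have "u \<in> M"
      using M(2) by blast
    then show False
      using eu u by auto
  qed
  then show ?thesis
    using M(1) by (auto simp: orthonormal_basis_def)
qed

text \<open>Pythagoras; it serves both Bessel's inequality and the Cauchy estimate for infinite
  expansions.\<close>

lemma orthonormal_cnorm_sum:
  assumes "orthonormal E" "finite F" "F \<subseteq> E"
  shows "(cnorm (\<Sum>e\<in>F. cscale (c e) e))\<^sup>2 = (\<Sum>e\<in>F. (cmod (c e))\<^sup>2)"
proof -
  let ?s = "\<Sum>e\<in>F. cscale (c e) e"
  have coeff: "cinner f ?s = c f" if "f \<in> F" for f
  proof -
    have "cinner f ?s = (\<Sum>e\<in>F. if f = e then c e else 0)"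
      unfolding cinner_sum_right using assms that
      by (intro sum.cong) (auto simp: cinner_simps orthonormal_def subset_iff)
    then show ?thesis
      using that \<open>finite F\<close> by simp
  qed
  have "cinner ?s e = cnj (c e)" if "e \<in> F" for e
    using coeff[OF that] by (subst cinner_commute) simp
  moreover have "cinner ?s ?s = (\<Sum>e\<in>F. c e * cinner ?s e)"
    by (subst cinner_sum_right) (simp add: cinner_cscale_right)
  ultimately have "cinner ?s ?s = of_real (\<Sum>e\<in>F. (cmod (c e))\<^sup>2)"
    unfolding of_real_sum complex_norm_square by simp
  then show ?thesis
    unfolding cinner_self of_real_eq_iff .
qed

text \<open>The finite expansion s satisfies <x, s> = <s, x> = <s, s> = b, so the residual x - s has
  square norm |x|^2 - b.\<close>

lemma Bessel:
  assumes "orthonormal E" "finite F" "F \<subseteq> E"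
  shows "(\<Sum>e\<in>F. (cmod (cinner e x))\<^sup>2) \<le> (cnorm x)\<^sup>2"
proof -
  let ?s = "\<Sum>e\<in>F. cscale (cinner e x) e" and ?b = "\<Sum>e\<in>F. (cmod (cinner e x))\<^sup>2"
  have xs: "cinner x ?s = of_real ?b"
    unfolding cinner_sum_right of_real_sum complex_norm_square
    by (intro sum.cong refl) (metis cinner_commute cinner_cscale_right)
  then have sx: "cinner ?s x = of_real ?b"
    by (subst cinner_commute) simp
  have ss: "cinner ?s ?s = of_real ?b"
    unfolding cinner_self orthonormal_cnorm_sum[OF assms] ..
  have "cinner (x - ?s) (x - ?s) = of_real ((cnorm x)\<^sup>2 - ?b)"
    by (simp only: cinner_diff_left cinner_diff_right xs sx ss cinner_self[of x]) simp
  then show ?thesis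
    using Re_cinner_nonneg[of "x - ?s"] by simp
qed

end

text \<open>Tying the inner product to the norm and real scaling of a Banach space type gives access
  to the library on bounded linear maps and infinite sums.\<close>

locale complex_hilbert_space = complex_inner_space cscale cinner
  for cscale :: "complex \<Rightarrow> 'a::banach \<Rightarrow> 'a" and cinner +
  assumes cnorm_eq_norm: "cnorm x = norm x"
    and cscale_of_real: "cscale (complex_of_real r) x = r *\<^sub>R x"
begin

section \<open>Continuity of the inner product and orthonormal expansions\<close>

lemma cinner_self_norm: "cinner x x = complex_of_real ((norm x)\<^sup>2)"
  by (simp add: cinner_self cnorm_eq_norm)

lemma norm_cscale: "norm (cscale c x) = cmod c * norm x"
  using cnorm_cscale by (simp add: cnorm_eq_norm)

lemma norm_cinner_le: "cmod (cinner x y) \<le> norm x * norm y"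
  using Cauchy_Schwarz by (simp add: cnorm_eq_norm)

lemma bounded_linear_cinner_right: "bounded_linear (cinner x)"
proof (rule bounded_linear_intro)
  show "cinner x (r *\<^sub>R y) = r *\<^sub>R cinner x y" for r y
    by (simp add: cinner_cscale_right scaleR_conv_of_real flip: cscale_of_real)
  show "cmod (cinner x y) \<le> norm y * norm x" for y
    by (simp add: norm_cinner_le mult.commute)
qed (rule cinner_add_right)

lemma cinner_eqI: "(\<And>z. cinner z x = cinner z y) \<Longrightarrow> x = y"
  using cinner_self_norm[of "x - y"] by (simp add: cinner_diff_right)

lemma bounded_linear_cscale_left: "bounded_linear (\<lambda>c. cscale c x)"
proof (rule bounded_linear_intro)
  show "cscale (b + c) x = cscale b x + cscale c x" for b c
    by (rule cinner_eqI) (simp add: cinner_simps distrib_right)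
  show "cscale (r *\<^sub>R c) x = r *\<^sub>R cscale c x" for r c
    by (rule cinner_eqI) (simp add: cinner_simps scaleR_conv_of_real flip: cscale_of_real)
  show "norm (cscale c x) \<le> norm c * norm x" for c
    by (simp add: norm_cscale)
qed

text \<open>Bessel makes the squared coefficients summable, by Pythagoras the finite partial sums
  are Cauchy, and by completeness they converge to some y. All coefficients of y - x vanish, so
  totality gives y = x.\<close>

lemma orthonormal_expansion:
  assumes "orthonormal_basis E"
  shows "((\<lambda>e. cscale (cinner e x) e) has_sum x) E"
proof -
  have E: "orthonormal E" and total: "\<And>x. (\<And>e. e \<in> E \<Longrightarrow> cinner e x = 0) \<Longrightarrow> x = 0"
    using assms by (auto simp: orthonormal_basis_def)
  define g where "g e = (cmod (cinner e x))\<^sup>2" for e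
  let ?f = "\<lambda>e. cscale (cinner e x) e"
  have g_nonneg: "0 \<le> g e" for e
    by (simp add: g_def)
  have "g summable_on E"
    using Bessel[OF E, of _ x] by (intro nonneg_bdd_above_summable_on bdd_aboveI) (auto simp: g_def)
  then obtain S where S: "(g has_sum S) E"
    by (auto simp: summable_on_def)
  have "\<exists>P. eventually P (finite_subsets_at_top E) \<and>
      (\<forall>F F'. P F \<and> P F' \<longrightarrow> dist (sum ?f F) (sum ?f F') < r)" if "r > 0" for r
  proof -
    from \<open>r > 0\<close> have r: "(r/2)\<^sup>2 / 2 > 0"
      by simp
    \<comment> \<open>The extra factor 1/2 in the tolerance turns the nonstrict approximation bound
      into the strict one wanted in \<open>close\<close>.\<close>
    obtain F0 where F0: "finite F0" "F0 \<subseteq> E" "dist (sum g F0) S \<le> (r/2)\<^sup>2 / 2"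
      using has_sum_finite_approximation[OF S r] by blast
    define P where "P F \<longleftrightarrow> finite F \<and> F0 \<subseteq> F \<and> F \<subseteq> E" for F
    have close: "dist (sum ?f F) (sum ?f F0) < r/2" if "P F" for F
    proof (rule power2_less_imp_less)
      have "(dist (sum ?f F) (sum ?f F0))\<^sup>2 = (norm (sum ?f (F - F0)))\<^sup>2"
        using that F0 by (simp add: dist_norm P_def sum_diff)
      also have "\<dots> = sum g (F - F0)"
        using that orthonormal_cnorm_sum[OF E, of "F - F0" "\<lambda>e. cinner e x"]
        by (auto simp: P_def cnorm_eq_norm g_def)
      also have "\<dots> = sum g F - sum g F0"
        using that F0 by (simp add: P_def sum_diff)
      also have "\<dots> \<le> S - sum g F0"
        using that finite_sum_le_has_sum[OF S] by (simp add: P_def g_nonneg)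
      also have "\<dots> \<le> (r/2)\<^sup>2 / 2"
        using F0(3) unfolding dist_real_def by linarith
      also have "\<dots> < (r/2)\<^sup>2"
        using r by simp
      finally show "(dist (sum ?f F) (sum ?f F0))\<^sup>2 < (r/2)\<^sup>2" .
    qed (use \<open>r > 0\<close> in simp)
    have "eventually P (finite_subsets_at_top E)"
      using F0 by (auto simp: P_def eventually_finite_subsets_at_top)
    moreover have "dist (sum ?f F) (sum ?f F') < r" if "P F" "P F'" for F F'
      by (rule dist_triangle_half_l[OF close[OF that(1)] close[OF that(2)]])
    ultimately show ?thesis
      by blast
  qed
  then have "cauchy_filter (filtermap (sum ?f) (finite_subsets_at_top E))"
    by (simp add: cauchy_filter_metric_filtermap)
  moreover have "complete (UNIV::'a set)"
    by (meson Cauchy_convergent UNIV_I complete_def convergent_def)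
  ultimately obtain y where y: "(?f has_sum y) E"
    using complete_uniform[where S=UNIV] by (force simp add: filterlim_def has_sum_def)
  have "cinner e y = cinner e x" if "e \<in> E" for e
  proof -
    have "((\<lambda>f. cinner e (?f f)) has_sum cinner e y) E"
      using has_sum_bounded_linear[OF bounded_linear_cinner_right y] .
    \<comment> \<open>By orthonormality only the term at f = e survives.\<close>
    moreover have "((\<lambda>f. cinner e (?f f)) has_sum cinner e x) E"
    proof (rule has_sum_finite_neutralI[where B="{e}"])
      show "cinner e x = (\<Sum>f\<in>{e}. cinner e (?f f))"
        using E that by (simp add: orthonormal_def cinner_simps)
    qed (use E that in \<open>auto simp: orthonormal_def cinner_simps\<close>)
    ultimately show ?thesis
      by (rule has_sum_unique)
  qed
  then have "y - x = 0"
    by (intro total) (simp add: cinner_simps)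
  with y show ?thesis
    by simp
qed

text \<open>The continuous functional \<open>cinner x\<close> is applied termwise to the expansion
  of y. The polarised form is what sums the cross terms in
  \<open>Hilbert_Schmidt_split\<close>.\<close>

lemma Parseval:
  assumes "orthonormal_basis E"
  shows "((\<lambda>e. cinner x e * cinner e y) has_sum cinner x y) E"
  using has_sum_bounded_linear[OF bounded_linear_cinner_right[of x]
      orthonormal_expansion[OF assms, of y]]
  by (simp add: cinner_cscale_right mult.commute)

lemma Parseval_norm:
  assumes "orthonormal_basis E"
  shows "((\<lambda>e. (cmod (cinner x e))\<^sup>2) has_sum (norm x)\<^sup>2) E"
proof -
  have "((\<lambda>e. Re (cinner x e * cinner e x)) has_sum Re (cinner x x)) E"
    by (intro has_sum_bounded_linear[OF bounded_linear_Re] Parseval assms)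
  moreover have "Re (cinner x e * cinner e x) = (cmod (cinner x e))\<^sup>2" for e
    by (subst (2) cinner_commute) (simp flip: complex_norm_square)
  ultimately show ?thesis
    by (simp add: cinner_self_norm)
qed

section \<open>Self-adjoint operators, and splitting off the row and column of a unit vector\<close>

definition self_adjoint :: "('a \<Rightarrow> 'a) \<Rightarrow> bool" where
  "self_adjoint B \<longleftrightarrow> (\<forall>x y. cinner (B x) y = cinner x (B y))"

text \<open>
  For self-adjoint \<open>B\<close> and a unit vector \<open>u\<close> this is \<open>B - P B P\<close>, where \<open>P\<close> is the orthogonal
  projection to the complement of \<open>u\<close>.
\<close>

definition corner_part :: "('a \<Rightarrow> 'a) \<Rightarrow> 'a \<Rightarrow> 'a \<Rightarrow> 'a" where
  "corner_part B u x = cscale (cinner (B u) x) u + cscale (cinner u x) (B u)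
     - cscale (cinner u (B u) * cinner u x) u"

text \<open>The constant 3 counts the three rank-one terms, each bounded by Cauchy-Schwarz. An
  operator equal to such a corner part is thereby seen to be bounded.\<close>

lemma norm_corner_part_le:
  assumes "norm u = 1"
  shows "norm (corner_part B u x) \<le> 3 * norm (B u) * norm x"
proof -
  have "norm (corner_part B u x)
      \<le> cmod (cinner (B u) x) * norm u + cmod (cinner u x) * norm (B u)
        + cmod (cinner u (B u)) * cmod (cinner u x) * norm u"
    unfolding corner_part_def norm_cscale[symmetric] norm_mult[symmetric]
    by (intro norm_triangle_le_diff add_right_mono norm_triangle_ineq)
  also have "\<dots> \<le> (norm (B u) * norm x) * 1 + (norm u * norm x) * norm (B u)
        + (norm u * norm (B u)) * (norm u * norm x) * 1"
    using assms by (intro add_mono mult_mono norm_cinner_le) auto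
  finally show ?thesis
    using assms by (simp add: ac_simps)
qed

text \<open>Only the vector \<open>B u\<close> enters the formula, so B may be any map, in
  particular a constant one.\<close>

lemma bounded_linear_corner_part: "bounded_linear (corner_part B u)"
proof -
  have "bounded_linear (\<lambda>x. cscale (cinner y x) z)" for y z
    by (rule bounded_linear_compose[OF bounded_linear_cscale_left bounded_linear_cinner_right])
  moreover have "bounded_linear (\<lambda>x. cscale (c * cinner y x) z)" for c y z
    by (rule bounded_linear_compose[OF bounded_linear_cscale_left
          bounded_linear_const_mult[OF bounded_linear_cinner_right]])
  ultimately show ?thesis
    unfolding corner_part_def[abs_def] by (intro bounded_linear_sub bounded_linear_add)
qed

text \<open>
  Neither term is summable on its own when \<open>B\<close> is not Hilbert-Schmidt.
\<close>

lemma Hilbert_Schmidt_split: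
  assumes B: "self_adjoint B" and u: "norm u = 1" and E: "orthonormal_basis E"
  shows "((\<lambda>e. (norm (B e))\<^sup>2 - (norm (B e - corner_part B u e))\<^sup>2) has_sum
           2 * (norm (B u))\<^sup>2 - (Re (cinner u (B u)))\<^sup>2) E"
proof -
  define v where "v = B u"
  define a where "a = Re (cinner u v)"
  define R where "R x = B x - corner_part B u x" for x
  have uu: "cinner u u = 1"
    using u by (simp add: cinner_self_norm)
  have B_sym: "cinner (B x) y = cinner x (B y)" for x y
    using B by (simp add: self_adjoint_def)
  have "cinner u v = cnj (cinner u v)"
    by (metis B_sym cinner_commute v_def)
  then have uv: "cinner u v = of_real a"
    by (simp add: a_def complex_eq_iff)
  then have vu: "cinner v u = of_real a"
    by (subst cinner_commute) simp
  have corner: "corner_part B u x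
      = cscale (cinner v x) u + cscale (cinner u x) v - cscale (of_real a * cinner u x) u" for x
    unfolding corner_part_def v_def[symmetric] uv ..
  \<comment> \<open>The remainder has range orthogonal to u, which removes from <R x, K> the parts
    of K along u.\<close>
  have uR: "cinner u (R x) = 0" for x
    using B_sym[of u x] by (simp add: R_def corner cinner_simps uu uv v_def[symmetric])
  have Rv: "cinner (R x) v = cinner x (R v)" for x
  proof -
    have "cinner (B x) v = cinner x (B v)"
      by (rule B_sym)
    then show ?thesis
      using cinner_commute[of x v] cinner_commute[of x u]
      by (simp add: R_def corner cinner_simps uv vu)
  qed
  \<comment> \<open>Expanding B x = R x + K leaves a cross term, which need not vanish at a single
    basis vector but only after summation.\<close>
  have pointwise: "(norm (B x))\<^sup>2 - (norm (R x))\<^sup>2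
      = (cmod (cinner v x))\<^sup>2 + ((norm v)\<^sup>2 - a\<^sup>2) * (cmod (cinner u x))\<^sup>2
        + 2 * Re (cinner u x * cinner x (R v))" for x
  proof -
    define p q where "p = cinner u x" and "q = cinner v x"
    define K where "K = corner_part B u x"
    have K: "K = cscale q u + cscale p v - cscale (of_real a * p) u"
      by (simp add: K_def corner p_def q_def)
    have RK: "cinner (R x) K = p * cinner x (R v)"
    proof -
      have "cinner (R x) u = 0"
        using uR cinner_commute[of "R x" u] by simp
      then show ?thesis
        by (simp add: K cinner_simps Rv)
    qed
    have KK: "cinner K K = q * cnj q + ((of_real (norm v))\<^sup>2 - (of_real a)\<^sup>2) * (p * cnj p)"
      by (simp add: K cinner_simps uu uv vu cinner_self_norm[of v])
        (simp add: algebra_simps power2_eq_square)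
    have "cinner (B x) (B x) = cinner (R x + K) (R x + K)"
      by (simp add: R_def K_def)
    also have "\<dots> = cinner (R x) (R x) + (cinner (R x) K + cnj (cinner (R x) K)) + cinner K K"
      using cinner_commute[of K "R x"] by (simp add: cinner_simps)
    finally have "complex_of_real ((norm (B x))\<^sup>2)
        = of_real ((norm (R x))\<^sup>2 + 2 * Re (p * cinner x (R v))
           + ((cmod q)\<^sup>2 + ((norm v)\<^sup>2 - a\<^sup>2) * (cmod p)\<^sup>2))"
      unfolding KK RK complex_add_cnj complex_norm_square[symmetric]
      unfolding cinner_self_norm by simp
    then show ?thesis
      unfolding of_real_eq_iff p_def q_def by linarith
  qed
  \<comment> \<open>Parseval sums the cross terms to 2 Re <u, R v>, which is zero by
    \<open>uR\<close>; the remaining terms give |v|^2 + (|v|^2 - a^2).\<close>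
  have "((\<lambda>e. Re (cinner u e * cinner e (R v))) has_sum Re (cinner u (R v))) E"
    by (intro has_sum_bounded_linear[OF bounded_linear_Re] Parseval E)
  then have "((\<lambda>e. (cmod (cinner v e))\<^sup>2 + ((norm v)\<^sup>2 - a\<^sup>2) * (cmod (cinner u e))\<^sup>2
        + 2 * Re (cinner u e * cinner e (R v))) has_sum
      (norm v)\<^sup>2 + ((norm v)\<^sup>2 - a\<^sup>2) * (norm u)\<^sup>2 + 2 * Re (cinner u (R v))) E"
    by (intro has_sum_add has_sum_cmult_right Parseval_norm E)
  then show ?thesis
    unfolding pointwise[symmetric] uR u by (simp add: R_def v_def a_def)
qed

text \<open>Self-adjointness moves R to the basis vector, <e, R x> = <R e, x> = 0, and totality
  concludes without a continuity argument.\<close>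

lemma zero_on_orthonormal_basis:
  assumes E: "orthonormal_basis E" and R: "self_adjoint R" and "\<And>e. e \<in> E \<Longrightarrow> R e = 0"
  shows "R x = 0"
proof -
  have "cinner e (R x) = 0" if "e \<in> E" for e
    using R assms(3)[OF that] by (metis self_adjoint_def cinner_zero_left)
  then show ?thesis
    using E by (auto simp: orthonormal_basis_def)
qed

lemma self_adjoint_diff:
  assumes "self_adjoint A" "self_adjoint B"
  shows "self_adjoint (\<lambda>x. A x - B x)"
  using assms by (simp add: self_adjoint_def cinner_simps)

lemma self_adjoint_corner_part:
  assumes "self_adjoint B"
  shows "self_adjoint (corner_part B u)"
proof -
  have real: "cnj (cinner u (B u)) = cinner u (B u)"
    using assms by (metis self_adjoint_def cinner_commute)
  have "cinner (corner_part B u x) y = cinner x (corner_part B u y)" for x y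
    using cinner_commute[of x u] cinner_commute[of x "B u"]
    by (simp add: corner_part_def cinner_simps real mult_ac)
  then show ?thesis
    by (simp add: self_adjoint_def)
qed

end

section \<open>The completion as a Banach space\<close>

interpretation euclidean: complex_inner_space scaleC "\<lambda>x y. bform (hconj x) (y::'h::euclidean_tvs)"
  rewrites "euclidean.cnorm = hnorm"
proof -
  show ips: "complex_inner_space scaleC (\<lambda>x y. bform (hconj x) (y::'h))"
  proof
    fix x y z :: 'h and c
    show "bform (hconj x) (y + z) = bform (hconj x) y + bform (hconj x) z"
      by (metis bform_sym bform_add)
    show "bform (hconj x) (scaleC c y) = c * bform (hconj x) y"
      by (metis bform_sym bform_scaleC)
    show "bform (hconj x) y = cnj (bform (hconj y) x)"
      by (metis bform_hconj bform_sym hconj_hconj)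
    show "0 < Re (bform (hconj x) x)" if "x \<noteq> 0"
      using that by (rule bform_pos)
  qed
  show "complex_inner_space.cnorm (\<lambda>x y. bform (hconj x) (y::'h)) = hnorm"
    by (intro ext) (simp add: complex_inner_space.cnorm_def[OF ips] hnorm_def)
qed

section \<open>The bilinear form, and functionals bounded in the Euclidean norm\<close>

lemma vector_space_scaleC: "vector_space (scaleC :: complex \<Rightarrow> 'h::euclidean_tvs \<Rightarrow> 'h)"
  by unfold_locales (simp_all add: scaleC_add_right scaleC_add_left scaleC_scaleC scaleC_one)

interpretation scaleC: vector_space "scaleC :: complex \<Rightarrow> 'h::euclidean_tvs \<Rightarrow> 'h"
  by (rule vector_space_scaleC)

lemma vector_space_complex_mult: "vector_space ((*) :: complex \<Rightarrow> complex \<Rightarrow> complex)"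
  by unfold_locales (simp_all add: algebra_simps)

lemma dual_iff: "f \<in> dual \<longleftrightarrow>
    (\<forall>x y. f (x + y) = f x + f y) \<and> (\<forall>c x. f (scaleC c x) = c * f x) \<and> continuous_on UNIV f"
  by (simp add: dual_def Vector_Spaces.linear_iff vector_space_scaleC vector_space_complex_mult)

lemma Lin_iff: "A \<in> Lin \<longleftrightarrow>
    (\<forall>x y. A (x + y) = A x + A y) \<and> (\<forall>c x. A (scaleC c x) = scaleC c (A x)) \<and> continuous_on UNIV A"
  by (simp add: Lin_def Vector_Spaces.linear_iff vector_space_scaleC)

lemma bform_add_right: "bform x (y + z) = bform x y + bform x z"
  by (metis bform_sym bform_add)

lemma bform_scaleC_right: "bform x (scaleC c y) = c * bform x y"
  by (metis bform_sym bform_scaleC)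

lemma bform_diff: "bform (x - y) z = bform x z - bform y z"
  using bform_add[of "x - y" y z] by simp

lemma hconj_0 [simp]: "hconj (0 :: 'h::euclidean_tvs) = 0"
  using hconj_add[of "0::'h" 0] by simp

lemma hconj_diff: "hconj (x - y) = hconj x - hconj y"
  using hconj_add[of "x - y" y] by simp

lemma hnorm_scaleC: "hnorm (scaleC c x) = cmod c * hnorm x"
  by (rule euclidean.cnorm_cscale)

lemma hnorm_0 [simp]: "hnorm (0::'h::euclidean_tvs) = 0"
  by simp

lemma hnorm_hconj: "hnorm (hconj x) = hnorm x"
  by (simp add: hnorm_def hconj_hconj bform_sym)

lemma bform_zero_left [simp]: "bform 0 x = 0"
  using bform_diff[of 0 0] by simp

lemma norm_bform_le: "cmod (bform x y) \<le> hnorm x * hnorm y"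
  using euclidean.Cauchy_Schwarz[of "hconj x" y] by (simp add: hconj_hconj hnorm_hconj)

lemma bform_nondegenerate:
  assumes "\<And>z. bform x z = bform y z"
  shows "x = y"
proof -
  have "bform (hconj (x - y)) (x - y) = 0"
    by (subst bform_sym) (simp add: bform_diff assms)
  then have "hnorm (x - y) = 0"
    by (simp add: hnorm_def)
  then show ?thesis
    by simp
qed

text \<open>Continuity in the given topology is a consequence, because the Euclidean norm is
  continuous. Membership in \<open>hbar\<close> can thus be treated by inequalities, without
  extended reals.\<close>

definition euclidean_dual :: "('h::euclidean_tvs \<Rightarrow> complex) set" where
  "euclidean_dual = {f. (\<forall>x y. f (x + y) = f x + f y) \<and> (\<forall>c x. f (scaleC c x) = c * f x) \<and>
     (\<exists>C. \<forall>x. cmod (f x) \<le> C * hnorm x)}"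

lemma euclidean_dual_diff:
  assumes "f \<in> euclidean_dual"
  shows "f (x - y) = f x - f y"
proof -
  have "f (x - y + y) = f (x - y) + f y"
    using assms unfolding euclidean_dual_def by blast
  then show ?thesis
    by simp
qed

text \<open>The Euclidean norm may be coarser than the given topology. Its continuity comes from
  that of conjugation and of the form at (0, 0), and makes Euclidean bounds imply topological
  continuity.\<close>

lemma tendsto_hnorm_diff: "((\<lambda>y. hnorm (y - x)) \<longlongrightarrow> 0) (nhds x)"
proof -
  have diff: "((\<lambda>y. y - x) \<longlongrightarrow> 0) (nhds x)"
    by (rule tendsto_eq_intros filterlim_ident | simp)+
  have conj: "((\<lambda>y. hconj (y - x)) \<longlongrightarrow> 0) (nhds x)"
    using filterlim_compose[OF tendsto_hconj_nhds[of 0] diff] by simp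
  have "((\<lambda>y. bform (hconj (y - x)) (y - x)) \<longlongrightarrow> 0) (nhds x)"
    using filterlim_compose[OF tendsto_bform_Pair[of 0 0] filterlim_Pair[OF conj diff]] by simp
  then show ?thesis
    unfolding hnorm_def by (auto intro!: tendsto_eq_intros)
qed

lemma euclidean_dual_subset_dual: "euclidean_dual \<subseteq> dual"
proof
  fix f :: "'a \<Rightarrow> complex"
  assume f: "f \<in> euclidean_dual"
  then obtain C where C: "\<And>x. cmod (f x) \<le> C * hnorm x"
    by (auto simp: euclidean_dual_def)
  have "(f \<longlongrightarrow> f x) (nhds x)" for x
  proof -
    have "((\<lambda>y. C * hnorm (y - x)) \<longlongrightarrow> C * 0) (nhds x)"
      by (intro tendsto_mult_left tendsto_hnorm_diff)
    then have lim: "((\<lambda>y. C * hnorm (y - x)) \<longlongrightarrow> 0) (nhds x)"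
      by simp
    have le: "cmod (f y - f x) \<le> C * hnorm (y - x)" for y
      using C[of "y - x"] unfolding euclidean_dual_diff[OF f] .
    have "((\<lambda>y. f y - f x) \<longlongrightarrow> 0) (nhds x)"
      by (rule Lim_null_comparison[OF always_eventually lim]) (simp add: le)
    then show ?thesis
      by (rule LIM_zero_cancel)
  qed
  then have "continuous_on UNIV f"
    by (simp add: continuous_on_def tendsto_at_iff_tendsto_nhds)
  then show "f \<in> dual"
    using f by (simp add: dual_iff euclidean_dual_def)
qed

text \<open>By homogeneity a bound on the unit ball is a bound by a multiple of
  \<open>hnorm\<close>; the zero vector, which cannot be normalised, is treated through
  additivity.\<close>

lemma dual_norm_le_iff:
  assumes f: "f \<in> dual" and "0 \<le> c"
  shows "dual_norm f \<le> ereal c \<longleftrightarrow> (\<forall>\<xi>. cmod (f \<xi>) \<le> c * hnorm \<xi>)"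
proof
  assume le: "dual_norm f \<le> ereal c"
  show "\<forall>\<xi>. cmod (f \<xi>) \<le> c * hnorm \<xi>"
  proof
    fix \<xi>
    show "cmod (f \<xi>) \<le> c * hnorm \<xi>"
    proof (cases "\<xi> = 0")
      case True
      moreover have "f 0 = 0"
        using f dual_iff[of f] by (metis add_cancel_left_left)
      ultimately show ?thesis
        by simp
    next
      case False
      then have pos: "hnorm \<xi> > 0"
        by (metis euclidean.cnorm_eq_0_iff euclidean.cnorm_nonneg order_le_less)
      let ?\<eta> = "scaleC (of_real (inverse (hnorm \<xi>))) \<xi>"
      have "hnorm ?\<eta> \<le> 1"
        using pos False by (simp add: hnorm_scaleC norm_inverse)
      then have "ereal (cmod (f ?\<eta>)) \<le> dual_norm f"
        unfolding dual_norm_def by (intro SUP_upper) simp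
      with le have "cmod (f ?\<eta>) \<le> c"
        by (metis ereal_less_eq(3) order_trans)
      moreover have "f ?\<eta> = of_real (inverse (hnorm \<xi>)) * f \<xi>"
        using f dual_iff[of f] by blast
      ultimately show ?thesis
        using pos by (simp add: norm_divide field_simps)
    qed
  qed
next
  assume *: "\<forall>\<xi>. cmod (f \<xi>) \<le> c * hnorm \<xi>"
  have "cmod (f \<xi>) \<le> c" if "hnorm \<xi> \<le> 1" for \<xi>
    using *[rule_format, of \<xi>] mult_left_mono[OF that \<open>0 \<le> c\<close>] by linarith
  then show "dual_norm f \<le> ereal c"
    unfolding dual_norm_def by (intro SUP_least) simp
qed

lemma dual_norm_nonneg: "0 \<le> dual_norm f"
  unfolding dual_norm_def
  by (rule SUP_upper2[of 0]) simp_all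

lemma dual_norm_euclidean_dual:
  assumes "f \<in> euclidean_dual"
  shows "dual_norm f = ereal (real_of_ereal (dual_norm f))"
proof -
  obtain C where C: "\<And>x. cmod (f x) \<le> C * hnorm x"
    using assms by (auto simp: euclidean_dual_def)
  \<comment> \<open>\<open>dual_norm_le_iff\<close> asks for a nonnegative constant, while C may be
    negative on the zero space.\<close>
  define D where "D = max C 0"
  have "0 \<le> D" "C \<le> D"
    by (simp_all add: D_def)
  then have "cmod (f x) \<le> D * hnorm x" for x
    using C[of x] mult_right_mono[OF \<open>C \<le> D\<close> euclidean.cnorm_nonneg[of x]] by linarith
  then have "dual_norm f \<le> ereal D"
    using \<open>0 \<le> D\<close> assms euclidean_dual_subset_dual by (subst dual_norm_le_iff) auto
  then show ?thesis
    using dual_norm_nonneg[of f] by (cases "dual_norm f") auto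
qed

lemma emb_euclidean_dual: "emb \<phi> \<in> euclidean_dual"
  unfolding euclidean_dual_def emb_def
  using norm_bform_le by (auto simp: bform_add_right bform_scaleC_right)

lemma dual_diff_mem:
  assumes "f \<in> dual" "g \<in> dual"
  shows "(\<lambda>x. f x - g x) \<in> dual"
  using assms by (auto simp: dual_iff algebra_simps intro: continuous_on_diff)

text \<open>This working description of the closure replaces \<open>dual_norm\<close> by explicit
  inequalities. One approximant at distance 1 already forces Euclidean boundedness.\<close>

lemma hbar_iff: "\<alpha> \<in> hbar \<longleftrightarrow>
    \<alpha> \<in> euclidean_dual \<and> (\<forall>\<epsilon>>0. \<exists>\<phi>. \<forall>\<xi>. cmod (\<alpha> \<xi> - bform \<phi> \<xi>) \<le> \<epsilon> * hnorm \<xi>)"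
proof
  assume \<alpha>: "\<alpha> \<in> hbar"
  then have dual: "\<alpha> \<in> dual"
    by (simp add: hbar_def)
  have approx: "\<exists>\<phi>. \<forall>\<xi>. cmod (\<alpha> \<xi> - bform \<phi> \<xi>) \<le> \<epsilon> * hnorm \<xi>" if "\<epsilon> > 0" for \<epsilon>
  proof -
    obtain \<phi> where "dual_norm (\<lambda>\<xi>. \<alpha> \<xi> - emb \<phi> \<xi>) < ereal \<epsilon>"
      using \<alpha> \<open>\<epsilon> > 0\<close> unfolding hbar_def by blast
    moreover have "(\<lambda>\<xi>. \<alpha> \<xi> - emb \<phi> \<xi>) \<in> dual"
      using dual emb_euclidean_dual euclidean_dual_subset_dual by (intro dual_diff_mem) auto
    ultimately have "\<forall>\<xi>. cmod (\<alpha> \<xi> - emb \<phi> \<xi>) \<le> \<epsilon> * hnorm \<xi>"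
      using that by (simp flip: dual_norm_le_iff)
    then show ?thesis
      by (auto simp: emb_def)
  qed
  obtain \<phi> where \<phi>: "\<And>\<xi>. cmod (\<alpha> \<xi> - bform \<phi> \<xi>) \<le> hnorm \<xi>"
    using approx[of 1] by auto
  have "cmod (\<alpha> \<xi>) \<le> (1 + hnorm \<phi>) * hnorm \<xi>" for \<xi>
    using norm_triangle_sub[of "\<alpha> \<xi>" "bform \<phi> \<xi>"] \<phi>[of \<xi>] norm_bform_le[of \<phi> \<xi>]
    by (simp add: algebra_simps)
  with dual approx show "\<alpha> \<in> euclidean_dual \<and> (\<forall>\<epsilon>>0. \<exists>\<phi>. \<forall>\<xi>. cmod (\<alpha> \<xi> - bform \<phi> \<xi>) \<le> \<epsilon> * hnorm \<xi>)"
    by (auto simp: euclidean_dual_def dual_iff)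
next
  assume *: "\<alpha> \<in> euclidean_dual \<and> (\<forall>\<epsilon>>0. \<exists>\<phi>. \<forall>\<xi>. cmod (\<alpha> \<xi> - bform \<phi> \<xi>) \<le> \<epsilon> * hnorm \<xi>)"
  have "\<exists>\<phi>. dual_norm (\<lambda>\<xi>. \<alpha> \<xi> - emb \<phi> \<xi>) < ereal \<epsilon>" if "\<epsilon> > 0" for \<epsilon>
  proof -
    \<comment> \<open>Half the tolerance is taken because the inequalities only yield a nonstrict
      bound on \<open>dual_norm\<close>.\<close>
    obtain \<phi> where "\<forall>\<xi>. cmod (\<alpha> \<xi> - emb \<phi> \<xi>) \<le> (\<epsilon>/2) * hnorm \<xi>"
      using *[THEN conjunct2, rule_format, OF half_gt_zero[OF \<open>\<epsilon> > 0\<close>]] by (auto simp: emb_def)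
    moreover have "(\<lambda>\<xi>. \<alpha> \<xi> - emb \<phi> \<xi>) \<in> dual"
      using * emb_euclidean_dual euclidean_dual_subset_dual by (intro dual_diff_mem) auto
    ultimately have "dual_norm (\<lambda>\<xi>. \<alpha> \<xi> - emb \<phi> \<xi>) \<le> ereal (\<epsilon>/2)"
      using that by (subst dual_norm_le_iff) auto
    also have "\<dots> < ereal \<epsilon>"
      using that by simp
    finally show ?thesis
      by blast
  qed
  with * show "\<alpha> \<in> hbar"
    using euclidean_dual_subset_dual by (auto simp: hbar_def)
qed

lemma hbar_approx:
  assumes "\<alpha> \<in> hbar" "\<epsilon> > 0"
  obtains \<phi> where "\<And>\<xi>. cmod (\<alpha> \<xi> - bform \<phi> \<xi>) \<le> \<epsilon> * hnorm \<xi>"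
  using assms unfolding hbar_iff by blast

lemma emb_hbar: "emb \<phi> \<in> hbar"
  unfolding hbar_iff using emb_euclidean_dual
  by (auto simp: emb_def intro!: exI[of _ \<phi>])

lemma zero_hbar: "(\<lambda>_. 0) \<in> hbar"
  using emb_hbar[of 0] unfolding emb_def bform_zero_left .

lemma add_hbar:
  assumes "\<alpha> \<in> hbar" "\<beta> \<in> hbar"
  shows "(\<lambda>\<xi>. \<alpha> \<xi> + \<beta> \<xi>) \<in> hbar"
proof -
  have dual: "\<alpha> \<in> euclidean_dual" "\<beta> \<in> euclidean_dual"
    using assms by (simp_all add: hbar_iff)
  obtain C D where "\<And>x. cmod (\<alpha> x) \<le> C * hnorm x" "\<And>x. cmod (\<beta> x) \<le> D * hnorm x"
    using dual unfolding euclidean_dual_def by blast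
  then have "cmod (\<alpha> x + \<beta> x) \<le> (C + D) * hnorm x" for x
    by (metis norm_triangle_le add_mono distrib_right)
  then have "\<exists>C. \<forall>x. cmod (\<alpha> x + \<beta> x) \<le> C * hnorm x"
    by blast
  then have "(\<lambda>\<xi>. \<alpha> \<xi> + \<beta> \<xi>) \<in> euclidean_dual"
    using dual unfolding euclidean_dual_def by (simp add: distrib_left add_ac)
  moreover have "\<exists>\<phi>. \<forall>\<xi>. cmod (\<alpha> \<xi> + \<beta> \<xi> - bform \<phi> \<xi>) \<le> \<epsilon> * hnorm \<xi>" if "\<epsilon> > 0" for \<epsilon>
  proof -
    obtain \<phi> where \<phi>: "\<And>\<xi>. cmod (\<alpha> \<xi> - bform \<phi> \<xi>) \<le> \<epsilon>/2 * hnorm \<xi>"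
      using hbar_approx[OF assms(1) half_gt_zero[OF \<open>\<epsilon> > 0\<close>]] by blast
    obtain \<psi> where \<psi>: "\<And>\<xi>. cmod (\<beta> \<xi> - bform \<psi> \<xi>) \<le> \<epsilon>/2 * hnorm \<xi>"
      using hbar_approx[OF assms(2) half_gt_zero[OF \<open>\<epsilon> > 0\<close>]] by blast
    have "cmod (\<alpha> \<xi> + \<beta> \<xi> - bform (\<phi> + \<psi>) \<xi>) \<le> \<epsilon> * hnorm \<xi>" for \<xi>
      using norm_triangle_ineq[of "\<alpha> \<xi> - bform \<phi> \<xi>" "\<beta> \<xi> - bform \<psi> \<xi>"] \<phi>[of \<xi>] \<psi>[of \<xi>]
      by (simp add: bform_add algebra_simps)
    then show ?thesis
      by blast
  qed
  ultimately show ?thesis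
    by (simp add: hbar_iff)
qed

lemma scale_hbar:
  assumes "\<alpha> \<in> hbar"
  shows "(\<lambda>\<xi>. c * \<alpha> \<xi>) \<in> hbar"
proof -
  have dual: "\<alpha> \<in> euclidean_dual"
    using assms by (simp add: hbar_iff)
  obtain C where "\<And>x. cmod (\<alpha> x) \<le> C * hnorm x"
    using dual unfolding euclidean_dual_def by blast
  then have "cmod (c * \<alpha> x) \<le> (cmod c * C) * hnorm x" for x
    by (simp add: norm_mult mult.assoc mult_left_mono)
  then have "\<exists>C. \<forall>x. cmod (c * \<alpha> x) \<le> C * hnorm x"
    by blast
  then have "(\<lambda>\<xi>. c * \<alpha> \<xi>) \<in> euclidean_dual"
    using dual unfolding euclidean_dual_def by (simp add: distrib_left mult_ac)
  moreover have "\<exists>\<phi>. \<forall>\<xi>. cmod (c * \<alpha> \<xi> - bform \<phi> \<xi>) \<le> \<epsilon> * hnorm \<xi>" if "\<epsilon> > 0" for \<epsilon>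
  proof (cases "c = 0")
    case True
    then show ?thesis
      using that by (auto intro!: exI[of _ 0])
  next
    case False
    then obtain \<phi> where \<phi>: "\<And>\<xi>. cmod (\<alpha> \<xi> - bform \<phi> \<xi>) \<le> \<epsilon> / cmod c * hnorm \<xi>"
      using hbar_approx[OF assms, of "\<epsilon> / cmod c"] \<open>\<epsilon> > 0\<close> by auto
    have "cmod (c * \<alpha> \<xi> - bform (scaleC c \<phi>) \<xi>) \<le> \<epsilon> * hnorm \<xi>" for \<xi>
    proof -
      have eq: "c * \<alpha> \<xi> - bform (scaleC c \<phi>) \<xi> = c * (\<alpha> \<xi> - bform \<phi> \<xi>)"
        by (simp add: bform_scaleC algebra_simps)
      then show ?thesis
        using \<phi>[of \<xi>] False unfolding eq norm_mult by (simp add: field_simps)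
    qed
    then show ?thesis
      by blast
  qed
  ultimately show ?thesis
    by (simp add: hbar_iff)
qed

lemma minus_hbar: "\<alpha> \<in> hbar \<Longrightarrow> (\<lambda>\<xi>. - \<alpha> \<xi>) \<in> hbar"
  using scale_hbar[of \<alpha> "-1"] by simp

lemma diff_hbar: "\<alpha> \<in> hbar \<Longrightarrow> \<beta> \<in> hbar \<Longrightarrow> (\<lambda>\<xi>. \<alpha> \<xi> - \<beta> \<xi>) \<in> hbar"
  using add_hbar[OF _ minus_hbar, of \<alpha> \<beta>] by simp

text \<open>A type for the closure makes the library on Banach spaces applicable, while
  \<open>fn\<close> keeps each element available as a functional, so that the set-based definitions
  can be translated.\<close>

typedef (overloaded) 'h completion = "hbar :: ('h::euclidean_tvs \<Rightarrow> complex) set"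
  morphisms fn Completion
  using zero_hbar by blast

lemma fn_eqI: "(\<And>\<xi>. fn x \<xi> = fn y \<xi>) \<Longrightarrow> x = y"
  by (simp add: fn_inject[symmetric] fun_eq_iff)

instantiation completion :: (euclidean_tvs) real_normed_vector
begin

definition "0 = Completion (\<lambda>_. 0)"
definition "x + y = Completion (\<lambda>\<xi>. fn x \<xi> + fn y \<xi>)"
definition "x - y = Completion (\<lambda>\<xi>. fn x \<xi> - fn y \<xi>)"
definition "- x = Completion (\<lambda>\<xi>. - fn x \<xi>)"
definition "r *\<^sub>R x = Completion (\<lambda>\<xi>. complex_of_real r * fn x \<xi>)"
text \<open>Nothing is lost in the conversion to a real, since the dual norm is finite on
  \<open>hbar\<close> by \<open>dual_norm_euclidean_dual\<close>.\<close>

definition "norm x = real_of_ereal (dual_norm (fn x))"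
definition "dist (x :: 'a completion) y = norm (x - y)"
definition "sgn (x :: 'a completion) = (inverse (norm x)) *\<^sub>R x"
definition uniformity_completion :: "('a completion \<times> 'a completion) filter" where
  "uniformity_completion = (INF e\<in>{0 <..}. principal {(x, y). dist x y < e})"
definition open_completion :: "'a completion set \<Rightarrow> bool" where
  "open_completion S \<longleftrightarrow> (\<forall>x\<in>S. \<forall>\<^sub>F (x', y) in uniformity. x' = x \<longrightarrow> y \<in> S)"

lemma fn_simps:
  "fn (0 :: 'a completion) = (\<lambda>_. 0)"
  "fn (x + y) = (\<lambda>\<xi>. fn x \<xi> + fn y \<xi>)"
  "fn (x - y) = (\<lambda>\<xi>. fn x \<xi> - fn y \<xi>)"
  "fn (- x) = (\<lambda>\<xi>. - fn x \<xi>)"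
  "fn (r *\<^sub>R x) = (\<lambda>\<xi>. complex_of_real r * fn x \<xi>)"
  by (simp_all add: zero_completion_def plus_completion_def minus_completion_def
      uminus_completion_def scaleR_completion_def Completion_inverse fn zero_hbar add_hbar
      diff_hbar minus_hbar scale_hbar)

lemma fn_euclidean_dual: "fn x \<in> euclidean_dual"
  using fn[of x] by (simp add: hbar_iff)

lemma norm_completion_nonneg: "0 \<le> norm (x :: 'a completion)"
  by (simp add: norm_completion_def real_of_ereal_pos dual_norm_nonneg)

lemma norm_completion_le_iff:
  fixes x :: "'a completion"
  assumes "0 \<le> c"
  shows "norm x \<le> c \<longleftrightarrow> (\<forall>\<xi>. cmod (fn x \<xi>) \<le> c * hnorm \<xi>)"
proof -
  have "norm x \<le> c \<longleftrightarrow> dual_norm (fn x) \<le> ereal c"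
    using dual_norm_euclidean_dual[OF fn_euclidean_dual[of x]]
    by (metis ereal_less_eq(3) norm_completion_def)
  then show ?thesis
    using dual_norm_le_iff[OF _ assms] fn_euclidean_dual[of x] euclidean_dual_subset_dual by blast
qed

lemma norm_fn_le: "cmod (fn x \<xi>) \<le> norm x * hnorm \<xi>"
  using norm_completion_le_iff[of "norm x" x] norm_completion_nonneg by blast

instance
proof
  fix x y z :: "'a completion" and a b :: real
  show "x + y + z = x + (y + z)" "x + y = y + x" "0 + x = x" "- x + x = 0" "x - y = x + - y"
    "a *\<^sub>R (x + y) = a *\<^sub>R x + a *\<^sub>R y" "(a + b) *\<^sub>R x = a *\<^sub>R x + b *\<^sub>R x"
    "a *\<^sub>R b *\<^sub>R x = (a * b) *\<^sub>R x" "1 *\<^sub>R x = x"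
    by (rule fn_eqI; simp add: fn_simps algebra_simps)+
  show "dist x y = norm (x - y)" "sgn x = inverse (norm x) *\<^sub>R x"
    by (simp_all add: dist_completion_def sgn_completion_def)
  show "(uniformity :: ('a completion \<times> 'a completion) filter)
      = (INF e\<in>{0 <..}. principal {(x, y). dist x y < e})"
    by (rule uniformity_completion_def)
  show "open U \<longleftrightarrow> (\<forall>x\<in>U. \<forall>\<^sub>F (x', y) in uniformity. x' = x \<longrightarrow> y \<in> U)" for U :: "'a completion set"
    by (rule open_completion_def)
  show "norm x = 0 \<longleftrightarrow> x = 0"
  proof
    assume "norm x = 0"
    then show "x = 0"
      using norm_fn_le[of x] by (intro fn_eqI) (simp add: fn_simps)
  next
    assume "x = 0"
    then have "norm x \<le> 0"
      by (subst norm_completion_le_iff) (simp_all add: fn_simps)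
    then show "norm x = 0"
      using norm_completion_nonneg[of x] by simp
  qed
  have "cmod (fn (x + y) \<xi>) \<le> (norm x + norm y) * hnorm \<xi>" for \<xi>
    unfolding fn_simps distrib_right by (intro norm_triangle_le add_mono norm_fn_le)
  then show "norm (x + y) \<le> norm x + norm y"
    by (subst norm_completion_le_iff) (simp_all add: norm_completion_nonneg)
  \<comment> \<open>Applied to \<open>inverse a\<close>, this one-sided estimate also gives the
    reverse inequality.\<close>
  have le: "norm (a *\<^sub>R x) \<le> \<bar>a\<bar> * norm x" for a and x :: "'a completion"
    by (subst norm_completion_le_iff)
      (simp_all add: norm_completion_nonneg fn_simps norm_mult mult.assoc mult_left_mono norm_fn_le)
  show "norm (a *\<^sub>R x) = \<bar>a\<bar> * norm x"
  proof (cases "a = 0")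
    case True
    then show ?thesis
      using le[of a x] norm_completion_nonneg[of "a *\<^sub>R x"] by simp
  next
    case False
    have "x = inverse a *\<^sub>R (a *\<^sub>R x)"
      using False by (intro fn_eqI) (simp add: fn_simps)
    then have "norm x \<le> \<bar>inverse a\<bar> * norm (a *\<^sub>R x)"
      using le by metis
    then have "\<bar>a\<bar> * norm x \<le> norm (a *\<^sub>R x)"
      using False by (simp add: field_simps)
    with le[of a x] show ?thesis
      by simp
  qed
qed

end

section \<open>The dense embedding into the completion, and completeness\<close>

definition incl :: "'h::euclidean_tvs \<Rightarrow> 'h completion" where
  "incl \<phi> = Completion (emb \<phi>)"

lemma fn_incl: "fn (incl \<phi>) = emb \<phi>"
  by (simp add: incl_def Completion_inverse emb_hbar)

lemma fn_incl_apply: "fn (incl \<phi>) \<xi> = bform \<phi> \<xi>"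
  by (simp add: fn_incl emb_def)

lemma incl_add: "incl (x + y) = incl x + incl y"
  by (rule fn_eqI) (simp add: fn_simps fn_incl_apply bform_add)

lemma incl_diff: "incl (x - y) = incl x - incl y"
  by (rule fn_eqI) (simp add: fn_simps fn_incl_apply bform_diff)

lemma incl_scaleR: "incl (scaleC (of_real r) x) = r *\<^sub>R incl x"
  by (rule fn_eqI) (simp add: fn_simps fn_incl_apply bform_scaleC)

text \<open>Cauchy-Schwarz gives one inequality. Evaluation at the conjugate vector, where the
  functional takes the squared norm as its value, gives the other.\<close>

lemma norm_incl: "norm (incl \<phi>) = hnorm \<phi>"
proof (rule antisym)
  show "norm (incl \<phi>) \<le> hnorm \<phi>"
    by (subst norm_completion_le_iff) (simp_all add: fn_incl_apply norm_bform_le)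
  have "(hnorm \<phi>)\<^sup>2 \<le> norm (incl \<phi>) * hnorm \<phi>"
    using norm_fn_le[of "incl \<phi>" "hconj \<phi>"] euclidean.cinner_self[of \<phi>]
    by (simp add: fn_incl_apply bform_sym[of \<phi>] hnorm_hconj norm_power)
  then show "hnorm \<phi> \<le> norm (incl \<phi>)"
    by (cases "0 < hnorm \<phi>") (auto simp: power2_eq_square intro: order_trans[OF _ norm_ge_zero])
qed

lemma incl_dense: "closure (range incl) = UNIV"
proof -
  have "\<exists>y\<in>range incl. dist y x < e" if "e > 0" for e and x :: "'a completion"
  proof -
    obtain \<phi> where "\<And>\<xi>. cmod (fn x \<xi> - bform \<phi> \<xi>) \<le> e/2 * hnorm \<xi>"
      using hbar_approx[OF fn half_gt_zero[OF \<open>e > 0\<close>]] by blast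
    then have "norm (x - incl \<phi>) \<le> e/2"
      using that by (subst norm_completion_le_iff) (simp_all add: fn_simps fn_incl_apply)
    then have "dist (incl \<phi>) x < e"
      using that by (simp add: dist_norm norm_minus_commute)
    then show ?thesis
      by blast
  qed
  then show ?thesis
    by (auto simp: closure_approachable)
qed

text \<open>Identities and estimates pass from embedded vectors to the completion by
  density.\<close>

lemma completion_induct:
  assumes "closed {x. P x}" "\<And>\<phi>. P (incl \<phi>)"
  shows "P x"
proof -
  have "closure (range incl) \<subseteq> {x. P x}"
    using assms by (intro closure_minimal) auto
  then show ?thesis
    by (auto simp: incl_dense)
qed

lemma bounded_linear_fn: "bounded_linear (\<lambda>x. fn x \<xi>)"
  by (rule bounded_linear_intro[where K="hnorm \<xi>"])
    (simp_all add: fn_simps scaleR_conv_of_real norm_fn_le)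

text \<open>The candidate limit is the pointwise limit f of the functionals. The Cauchy condition
  makes the convergence uniform relative to \<open>hnorm\<close>, and approximating a late X n by an
  embedded vector puts f into \<open>hbar\<close>.\<close>

instance completion :: (euclidean_tvs) banach
proof
  fix X :: "nat \<Rightarrow> 'a completion"
  assume X: "Cauchy X"
  define f where "f \<xi> = lim (\<lambda>n. fn (X n) \<xi>)" for \<xi>
  have f: "(\<lambda>n. fn (X n) \<xi>) \<longlonglongrightarrow> f \<xi>" for \<xi>
    using Cauchy_convergent[OF bounded_linear.Cauchy[OF bounded_linear_fn X]]
    by (simp add: f_def convergent_LIMSEQ_iff)
  have lim: "\<exists>N. \<forall>n\<ge>N. \<forall>\<xi>. cmod (f \<xi> - fn (X n) \<xi>) \<le> \<epsilon> * hnorm \<xi>" if "\<epsilon> > 0" for \<epsilon>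
  proof -
    obtain N where N: "\<And>m n. m \<ge> N \<Longrightarrow> n \<ge> N \<Longrightarrow> norm (X m - X n) < \<epsilon>"
      using CauchyD[OF X \<open>\<epsilon> > 0\<close>] by blast
    \<comment> \<open>In the Cauchy estimate n stays fixed while the other index tends to
      infinity.\<close>
    have "cmod (f \<xi> - fn (X n) \<xi>) \<le> \<epsilon> * hnorm \<xi>" if "n \<ge> N" for n \<xi>
    proof (rule tendsto_upperbound)
      show "(\<lambda>m. cmod (fn (X m) \<xi> - fn (X n) \<xi>)) \<longlonglongrightarrow> cmod (f \<xi> - fn (X n) \<xi>)"
        by (intro tendsto_norm tendsto_diff f tendsto_const)
      have "cmod (fn (X m) \<xi> - fn (X n) \<xi>) \<le> \<epsilon> * hnorm \<xi>" if "m \<ge> N" for m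
        using norm_fn_le[of "X m - X n" \<xi>] N[OF that \<open>n \<ge> N\<close>]
          mult_right_mono[of "norm (X m - X n)" \<epsilon> "hnorm \<xi>"]
        by (simp add: fn_simps)
      then show "\<forall>\<^sub>F m in sequentially. cmod (fn (X m) \<xi> - fn (X n) \<xi>) \<le> \<epsilon> * hnorm \<xi>"
        by (auto simp: eventually_sequentially)
    qed simp
    then show ?thesis
      by blast
  qed
  have "f \<in> hbar"
  proof -
    have add: "f (x + y) = f x + f y" for x y
    proof (rule LIMSEQ_unique[OF f])
      have "fn (X n) (x + y) = fn (X n) x + fn (X n) y" for n
        using fn_euclidean_dual[of "X n"] unfolding euclidean_dual_def by blast
      then show "(\<lambda>n. fn (X n) (x + y)) \<longlonglongrightarrow> f x + f y"
        using tendsto_add[OF f f] by simp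
    qed
    have scale: "f (scaleC c x) = c * f x" for c x
    proof (rule LIMSEQ_unique[OF f])
      have "fn (X n) (scaleC c x) = c * fn (X n) x" for n
        using fn_euclidean_dual[of "X n"] unfolding euclidean_dual_def by blast
      then show "(\<lambda>n. fn (X n) (scaleC c x)) \<longlonglongrightarrow> c * f x"
        using tendsto_mult_left[OF f] by simp
    qed
    obtain N where N: "\<And>\<xi>. cmod (f \<xi> - fn (X N) \<xi>) \<le> hnorm \<xi>"
      using lim[of 1] by auto
    have "cmod (f \<xi>) \<le> (1 + norm (X N)) * hnorm \<xi>" for \<xi>
      using norm_triangle_sub[of "f \<xi>" "fn (X N) \<xi>"] N[of \<xi>] norm_fn_le[of "X N" \<xi>]
      by (simp add: algebra_simps)
    then have dual: "f \<in> euclidean_dual"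
      using add scale by (auto simp: euclidean_dual_def)
    have "\<exists>\<phi>. \<forall>\<xi>. cmod (f \<xi> - bform \<phi> \<xi>) \<le> \<epsilon> * hnorm \<xi>" if "\<epsilon> > 0" for \<epsilon>
    proof -
      obtain n where n: "\<And>\<xi>. cmod (f \<xi> - fn (X n) \<xi>) \<le> \<epsilon>/2 * hnorm \<xi>"
        using lim[of "\<epsilon>/2"] \<open>\<epsilon> > 0\<close> by auto
      obtain \<phi> where \<phi>: "\<And>\<xi>. cmod (fn (X n) \<xi> - bform \<phi> \<xi>) \<le> \<epsilon>/2 * hnorm \<xi>"
        using hbar_approx[OF fn half_gt_zero[OF \<open>\<epsilon> > 0\<close>]] by blast
      have "cmod (f \<xi> - bform \<phi> \<xi>) \<le> \<epsilon> * hnorm \<xi>" for \<xi>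
        using norm_triangle_ineq[of "f \<xi> - fn (X n) \<xi>" "fn (X n) \<xi> - bform \<phi> \<xi>"] n[of \<xi>] \<phi>[of \<xi>]
        by simp
      then show ?thesis
        by blast
    qed
    with dual show ?thesis
      by (simp add: hbar_iff)
  qed
  then have fn_f: "fn (Completion f) = f"
    by (rule Completion_inverse)
  have "X \<longlonglongrightarrow> Completion f"
  proof (rule LIMSEQ_I)
    fix r :: real
    assume "0 < r"
    then obtain N where "\<And>n \<xi>. n \<ge> N \<Longrightarrow> cmod (f \<xi> - fn (X n) \<xi>) \<le> r/2 * hnorm \<xi>"
      using lim[of "r/2"] by auto
    then have "norm (X n - Completion f) \<le> r/2" if "n \<ge> N" for n
      using that \<open>0 < r\<close> by (subst norm_completion_le_iff) (simp_all add: fn_simps fn_f norm_minus_commute)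
    then show "\<exists>N. \<forall>n\<ge>N. norm (X n - Completion f) < r"
      using \<open>0 < r\<close> by (intro exI[of _ N]) force
  qed
  then show "convergent X"
    by (rule convergentI)
qed

section \<open>Extension by continuity\<close>

text \<open>Homogeneity is asked for real scalars only, so that antilinear maps such as conjugation
  can be extended as well.\<close>

definition euclidean_bounded :: "('h::euclidean_tvs \<Rightarrow> 'b::real_normed_vector) \<Rightarrow> bool" where
  "euclidean_bounded f \<longleftrightarrow> (\<forall>x y. f (x + y) = f x + f y) \<and>
     (\<forall>r x. f (scaleC (complex_of_real r) x) = r *\<^sub>R f x) \<and> (\<exists>C. \<forall>x. norm (f x) \<le> C * hnorm x)"

text \<open>A Lipschitz map from a dense subspace to a complete space extends; additivity,
  homogeneity and the bound then pass to the limit.\<close>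

lemma euclidean_bounded_extension:
  fixes f :: "'h::euclidean_tvs \<Rightarrow> 'b::banach"
  assumes "euclidean_bounded f"
  shows "\<exists>F. bounded_linear F \<and> (\<forall>\<phi>. F (incl \<phi>) = f \<phi>)"
proof -
  have add: "f (x + y) = f x + f y" and scale: "f (scaleC (complex_of_real r) x) = r *\<^sub>R f x" for x y r
    using assms by (auto simp: euclidean_bounded_def)
  obtain C where C: "\<And>x. norm (f x) \<le> C * hnorm x"
    using assms by (auto simp: euclidean_bounded_def)
  have diff: "f (x - y) = f x - f y" for x y
    using add[of "x - y" y] by simp
  have lipschitz: "norm (f x - f y) \<le> C * norm (incl x - incl y)" for x y
    using C[of "x - y"] by (simp add: diff norm_incl flip: incl_diff)
  \<comment> \<open>The choice made by \<open>inv incl\<close> is harmless: vectors with equal image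
    have equal values by the Lipschitz estimate.\<close>
  define g where "g = f \<circ> inv incl"
  have g: "g (incl \<phi>) = f \<phi>" for \<phi>
    using lipschitz[of "inv incl (incl \<phi>)" \<phi>] by (simp add: g_def f_inv_into_f)
  have "uniformly_continuous_on (range incl) g"
  proof -
    have "dist (g x) (g y) \<le> max C 0 * dist x y" if "x \<in> range incl" "y \<in> range incl" for x y
    proof -
      obtain \<phi> \<psi> where "x = incl \<phi>" "y = incl \<psi>"
        using \<open>x \<in> range incl\<close> \<open>y \<in> range incl\<close> by blast
      then have "dist (g x) (g y) \<le> C * dist x y"
        using lipschitz[of \<phi> \<psi>] by (simp add: g dist_norm)
      also have "\<dots> \<le> max C 0 * dist x y"
        by (intro mult_right_mono) auto
      finally show ?thesis .
    qed
    then have "(max C 0)-lipschitz_on (range incl) g"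
      by (intro lipschitz_onI) auto
    then show ?thesis
      by (rule lipschitz_on_uniformly_continuous)
  qed
  then obtain F where F: "uniformly_continuous_on UNIV F" "\<And>x. x \<in> range incl \<Longrightarrow> g x = F x"
    using uniformly_continuous_on_extension_on_closure[of "range incl" g] by (metis incl_dense)
  have F_incl: "F (incl \<phi>) = f \<phi>" for \<phi>
    using F(2)[of "incl \<phi>"] by (simp add: g)
  have "continuous_on UNIV F"
    using F(1) by (rule uniformly_continuous_imp_continuous)
  then have cont: "continuous_on UNIV (\<lambda>x. F (h x))" if "continuous_on UNIV h" for h :: "'h completion \<Rightarrow> 'h completion"
    using that by (metis continuous_on_compose2 subset_UNIV)
  \<comment> \<open>Additivity is extended in one argument at a time.\<close>
  have add_incl: "F (x + incl \<psi>) = F x + F (incl \<psi>)" for x \<psi>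
    by (rule completion_induct[where x=x])
      (auto simp: F_incl add simp flip: incl_add intro!: closed_Collect_eq continuous_intros cont)
  have "F (x + y) = F x + F y" for x y
    by (rule completion_induct[where x=y]) (auto simp: add_incl intro!: closed_Collect_eq continuous_intros cont)
  moreover have "F (r *\<^sub>R x) = r *\<^sub>R F x" for r x
    by (rule completion_induct[where x=x])
      (auto simp: F_incl scale simp flip: incl_scaleR intro!: closed_Collect_eq continuous_intros cont)
  moreover have "norm (F x) \<le> norm x * C" for x
    by (rule completion_induct[where x=x])
      (auto simp: F_incl norm_incl C mult.commute intro!: closed_Collect_le continuous_intros cont)
  ultimately have "bounded_linear F"
    by (rule bounded_linear_intro)
  with F_incl show ?thesis
    by blast
qed

definition extend :: "('h::euclidean_tvs \<Rightarrow> 'b::banach) \<Rightarrow> 'h completion \<Rightarrow> 'b" where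
  "extend f = (SOME F. bounded_linear F \<and> (\<forall>\<phi>. F (incl \<phi>) = f \<phi>))"

lemma
  assumes "euclidean_bounded f"
  shows bounded_linear_extend: "bounded_linear (extend f)"
    and extend_incl: "extend f (incl \<phi>) = f \<phi>"
  using someI_ex[OF euclidean_bounded_extension[OF assms]] by (simp_all add: extend_def)

section \<open>Form, scaling and conjugation on the completion\<close>

lemma bounded_linear_eqI:
  fixes F G :: "'h::euclidean_tvs completion \<Rightarrow> 'b::real_normed_vector"
  assumes "bounded_linear F" "bounded_linear G" "\<And>\<phi>. F (incl \<phi>) = G (incl \<phi>)"
  shows "F x = G x"
  by (rule completion_induct[where x=x])
    (use assms in \<open>auto intro!: closed_Collect_eq linear_continuous_on\<close>)

text \<open>An element y of the completion is already a functional on the original space, so only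
  the first argument has to be extended by continuity.\<close>

definition cform :: "'h::euclidean_tvs completion \<Rightarrow> 'h completion \<Rightarrow> complex" where
  "cform x y = extend (fn y) x"

lemma euclidean_bounded_fn: "euclidean_bounded (fn y)"
  using fn_euclidean_dual[of y]
  by (auto simp: euclidean_bounded_def euclidean_dual_def scaleR_conv_of_real)

lemma cform_incl_left: "cform (incl \<phi>) y = fn y \<phi>"
  by (simp add: cform_def extend_incl euclidean_bounded_fn)

lemma bounded_linear_cform_left: "bounded_linear (\<lambda>x. cform x y)"
  unfolding cform_def by (rule bounded_linear_extend[OF euclidean_bounded_fn])

lemma bounded_bilinear_cform: "bounded_bilinear cform"
proof
  fix a a' b b' :: "'a completion" and r :: real
  show "cform (a + a') b = cform a b + cform a' b"
    by (rule linear_add[OF bounded_linear.linear[OF bounded_linear_cform_left]])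
  show "cform (r *\<^sub>R a) b = r *\<^sub>R cform a b"
    by (rule linear_scale[OF bounded_linear.linear[OF bounded_linear_cform_left]])
  show "cform a (b + b') = cform a b + cform a b'"
    by (rule bounded_linear_eqI[where x=a])
      (auto simp: cform_incl_left fn_simps intro: bounded_linear_cform_left bounded_linear_add)
  show "cform a (r *\<^sub>R b) = r *\<^sub>R cform a b"
    by (rule bounded_linear_eqI[where x=a])
      (auto simp: cform_incl_left fn_simps scaleR_conv_of_real
        intro: bounded_linear_cform_left bounded_linear_const_mult)
  have "norm (cform a b) \<le> norm a * norm b * 1" for a b :: "'a completion"
  proof (rule completion_induct[where x=a])
    show "closed {x. norm (cform x b) \<le> norm x * norm b * 1}"
      by (intro closed_Collect_le continuous_intros linear_continuous_on bounded_linear_cform_left)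
    show "norm (cform (incl \<phi>) b) \<le> norm (incl \<phi>) * norm b * 1" for \<phi>
      using norm_fn_le[of b \<phi>] by (simp add: cform_incl_left norm_incl mult.commute)
  qed
  then show "\<exists>K. \<forall>a b :: 'a completion. norm (cform a b) \<le> norm a * norm b * K"
    by blast
qed

lemmas bounded_linear_cform_right = bounded_bilinear.bounded_linear_right[OF bounded_bilinear_cform]

lemma cform_commute: "cform x y = cform y x"
proof (rule bounded_linear_eqI[where x=y])
  show "cform x (incl \<psi>) = cform (incl \<psi>) x" for \<psi>
    by (rule bounded_linear_eqI[where x=x])
      (auto simp: cform_incl_left fn_incl_apply bform_sym
        intro: bounded_linear_cform_left bounded_linear_fn)
qed (rule bounded_linear_cform_left bounded_linear_cform_right)+

lemma cform_incl_right: "cform x (incl \<phi>) = fn x \<phi>"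
  by (simp add: cform_commute[of x] cform_incl_left)

lemma cform_incl: "cform (incl \<phi>) (incl \<psi>) = bform \<phi> \<psi>"
  by (simp add: cform_incl_right fn_incl_apply)

definition cscale :: "complex \<Rightarrow> 'h::euclidean_tvs completion \<Rightarrow> 'h completion" where
  "cscale c x = Completion (\<lambda>\<xi>. c * fn x \<xi>)"

lemma fn_cscale: "fn (cscale c x) = (\<lambda>\<xi>. c * fn x \<xi>)"
  by (simp add: cscale_def Completion_inverse scale_hbar fn)

lemma cform_cscale_right: "cform x (cscale c y) = c * cform x y"
  by (rule bounded_linear_eqI[where x=x])
    (auto simp: cform_incl_left fn_cscale intro: bounded_linear_cform_left bounded_linear_const_mult)

definition cconj :: "'h::euclidean_tvs completion \<Rightarrow> 'h completion" where
  "cconj = extend (\<lambda>\<phi>. incl (hconj \<phi>))"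

lemma euclidean_bounded_incl_hconj: "euclidean_bounded (\<lambda>\<phi>. incl (hconj \<phi>))"
  by (auto simp: euclidean_bounded_def hconj_add hconj_scaleC incl_add incl_scaleR norm_incl
      hnorm_hconj intro!: exI[of _ 1])

lemma bounded_linear_cconj: "bounded_linear cconj"
  unfolding cconj_def by (rule bounded_linear_extend[OF euclidean_bounded_incl_hconj])

lemma cconj_incl: "cconj (incl \<phi>) = incl (hconj \<phi>)"
  unfolding cconj_def by (rule extend_incl[OF euclidean_bounded_incl_hconj])

lemma bounded_linear_cnj_fn: "bounded_linear (\<lambda>x. cnj (fn x \<xi>))"
  by (rule bounded_linear_compose[OF bounded_linear_cnj bounded_linear_fn])

lemma fn_cconj: "fn (cconj x) \<xi> = cnj (fn x (hconj \<xi>))"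
  by (rule bounded_linear_eqI[where x=x])
    (auto simp: cconj_incl fn_incl_apply bform_hconj[symmetric] hconj_hconj
      intro: bounded_linear_compose[OF bounded_linear_fn bounded_linear_cconj] bounded_linear_cnj_fn)

lemma cconj_conj: "cconj (cconj x) = x"
  by (rule fn_eqI) (simp add: fn_cconj hconj_hconj)

lemma cform_cconj: "cform (cconj x) (cconj y) = cnj (cform x y)"
proof (rule bounded_linear_eqI[where x=x])
  show "bounded_linear (\<lambda>x. cform (cconj x) (cconj y))"
    by (rule bounded_linear_compose[OF bounded_linear_cform_left bounded_linear_cconj])
  show "bounded_linear (\<lambda>x. cnj (cform x y))"
    by (rule bounded_linear_compose[OF bounded_linear_cnj bounded_linear_cform_left])
qed (simp add: cconj_incl cform_incl_left fn_cconj hconj_hconj)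

definition cinner :: "'h::euclidean_tvs completion \<Rightarrow> 'h completion \<Rightarrow> complex" where
  "cinner x y = cform (cconj x) y"

text \<open>The norm was introduced as a supremum; continuity from embedded vectors identifies it
  with the norm of the inner product. Both sides are quadratic in x, hence
  \<open>completion_induct\<close> and not a comparison of linear maps.\<close>

lemma cinner_self_completion: "cinner x x = complex_of_real ((norm x)\<^sup>2)"
proof (rule completion_induct[where x=x])
  have "continuous_on UNIV (\<lambda>x. cform (cconj x) (x :: 'a completion))"
    by (intro bounded_bilinear.continuous_on[OF bounded_bilinear_cform]
        linear_continuous_on bounded_linear_cconj continuous_on_id)
  then show "closed {x :: 'a completion. cinner x x = complex_of_real ((norm x)\<^sup>2)}"
    unfolding cinner_def by (intro closed_Collect_eq continuous_intros)
  show "cinner (incl \<phi>) (incl \<phi>) = complex_of_real ((norm (incl \<phi>))\<^sup>2)" for \<phi> :: 'a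
    by (simp add: cinner_def cconj_incl cform_incl norm_incl euclidean.cinner_self)
qed

interpretation completion: complex_hilbert_space cscale
  "cinner :: 'h::euclidean_tvs completion \<Rightarrow> 'h completion \<Rightarrow> complex"
proof -
  interpret complex_inner_space cscale "cinner :: 'h completion \<Rightarrow> 'h completion \<Rightarrow> complex"
  proof
    fix x y z :: "'h completion" and c
    show "cinner x (y + z) = cinner x y + cinner x z"
      by (simp add: cinner_def bounded_bilinear.add_right[OF bounded_bilinear_cform])
    show "cinner x (cscale c y) = c * cinner x y"
      by (simp add: cinner_def cform_cscale_right)
    show "cinner x y = cnj (cinner y x)"
      using cform_cconj[of "cconj y" x] by (simp add: cinner_def cconj_conj cform_commute)
    show "0 < Re (cinner x x)" if "x \<noteq> 0"
      using that by (simp add: cinner_self_completion)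
  qed
  show "complex_hilbert_space cscale (cinner :: 'h completion \<Rightarrow> 'h completion \<Rightarrow> complex)"
  proof
    fix x :: "'h completion" and r :: real
    show "cnorm x = norm x"
      by (simp add: cnorm_def cinner_self_completion)
    show "cscale (complex_of_real r) x = r *\<^sub>R x"
      by (rule fn_eqI) (simp add: fn_cscale fn_simps)
  qed
qed

section \<open>Limits along \<open>approx\<close> as values in the completion\<close>

lemma dual_norm_fn_diff: "dual_norm (\<lambda>\<xi>. fn x \<xi> - emb \<phi> \<xi>) = ereal (dist (incl \<phi>) x)"
  using dual_norm_euclidean_dual[OF fn_euclidean_dual[of "x - incl \<phi>"]]
  by (simp add: norm_completion_def dist_commute[of _ x] dist_norm[of x] fn_simps fn_incl)

lemma approx_fn: "approx (fn x) = filtercomap (\<lambda>\<phi>. ereal (dist (incl \<phi>) x)) (nhds 0)"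
  by (simp add: approx_def dual_norm_fn_diff)

lemma tendsto_incl_approx: "(incl \<longlongrightarrow> x) (approx (fn x))"
proof -
  have "((\<lambda>\<phi>. ereal (dist (incl \<phi>) x)) \<longlongrightarrow> ereal 0) (approx (fn x))"
    unfolding approx_fn zero_ereal_def[symmetric] by (rule filterlim_filtercomap)
  then have "((\<lambda>\<phi>. dist (incl \<phi>) x) \<longlongrightarrow> 0) (approx (fn x))"
    by simp
  then show ?thesis
    by (subst tendsto_dist_iff)
qed

text \<open>A limit taken by \<open>Lim\<close> is determined only along a proper filter; density of
  the embedded vectors provides that.\<close>

lemma approx_fn_neq_bot: "approx (fn x) \<noteq> bot"
  unfolding approx_fn
proof (rule filtercomap_neq_bot)
  fix P :: "ereal \<Rightarrow> bool"
  assume P: "eventually P (nhds 0)"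
  have "x \<in> closure (range incl)"
    by (simp add: incl_dense)
  then obtain X where X: "\<And>n. X n \<in> range incl" "X \<longlonglongrightarrow> x"
    by (auto simp: closure_sequential)
  have "(\<lambda>n. ereal (dist (X n) x)) \<longlonglongrightarrow> ereal 0"
    using tendsto_dist_iff[THEN iffD1, OF X(2)] by (rule tendsto_ereal)
  then have "eventually (\<lambda>n. P (ereal (dist (X n) x))) sequentially"
    using P by (auto simp: filterlim_iff zero_ereal_def[symmetric])
  then obtain n where "P (ereal (dist (X n) x))"
    using eventually_happens'[OF sequentially_bot] by blast
  then show "\<exists>\<phi>. P (ereal (dist (incl \<phi>) x))"
    using X(1)[of n] by auto
qed

lemma tendsto_incl_fst: "((\<lambda>p. incl (fst p)) \<longlongrightarrow> x) (approx (fn x) \<times>\<^sub>F approx (fn y))"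
  by (rule filterlim_compose[OF tendsto_incl_approx filterlim_fst])

lemma tendsto_incl_snd: "((\<lambda>p. incl (snd p)) \<longlongrightarrow> y) (approx (fn x) \<times>\<^sub>F approx (fn y))"
  by (rule filterlim_compose[OF tendsto_incl_approx filterlim_snd])

text \<open>Joint continuity of \<open>cform\<close> gives the limit along the product filter, and
  on embedded pairs \<open>cform\<close> agrees with \<open>bform\<close>.\<close>

lemma bform_bar_fn: "bform_bar (fn x) (fn y) = cform x y"
proof -
  have "((\<lambda>p. cform (incl (fst p)) (incl (snd p))) \<longlongrightarrow> cform x y) (approx (fn x) \<times>\<^sub>F approx (fn y))"
    by (intro bounded_bilinear.tendsto[OF bounded_bilinear_cform] tendsto_incl_fst tendsto_incl_snd)
  then show ?thesis
    unfolding bform_bar_def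
    by (intro tendsto_Lim)
      (simp_all add: prod_filter_eq_bot approx_fn_neq_bot cform_incl case_prod_unfold)
qed

lemma inner_bar_fn: "inner_bar (fn x) (fn y) = cinner x y"
proof -
  have "((\<lambda>p. cform (cconj (incl (fst p))) (incl (snd p))) \<longlongrightarrow> cform (cconj x) y)
      (approx (fn x) \<times>\<^sub>F approx (fn y))"
    by (intro bounded_bilinear.tendsto[OF bounded_bilinear_cform]
        bounded_linear.tendsto[OF bounded_linear_cconj] tendsto_incl_fst tendsto_incl_snd)
  then show ?thesis
    unfolding inner_bar_def cinner_def
    by (intro tendsto_Lim)
      (simp_all add: prod_filter_eq_bot approx_fn_neq_bot cconj_incl cform_incl case_prod_unfold)
qed

text \<open>Evaluation at a point is continuous on the completion, so the pointwise limit in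
  \<open>map_bar\<close> is the value of the norm-continuous extension.\<close>

lemma map_bar_fn:
  assumes "euclidean_bounded (\<lambda>\<phi>. incl (T \<phi>))"
  shows "map_bar T (fn x) = fn (extend (\<lambda>\<phi>. incl (T \<phi>)) x)"
proof
  fix \<xi>
  have "((\<lambda>\<phi>. fn (extend (\<lambda>\<phi>. incl (T \<phi>)) (incl \<phi>)) \<xi>) \<longlongrightarrow> fn (extend (\<lambda>\<phi>. incl (T \<phi>)) x) \<xi>)
      (approx (fn x))"
    by (intro bounded_linear.tendsto[OF bounded_linear_fn]
        bounded_linear.tendsto[OF bounded_linear_extend[OF assms]] tendsto_incl_approx)
  then show "map_bar T (fn x) \<xi> = fn (extend (\<lambda>\<phi>. incl (T \<phi>)) x) \<xi>"
    unfolding map_bar_def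
    by (intro tendsto_Lim) (simp_all add: approx_fn_neq_bot extend_incl[OF assms] fn_incl)
qed

lemma hconj_bar_fn: "hconj_bar (fn x) = fn (cconj x)"
  unfolding hconj_bar_def cconj_def by (rule map_bar_fn[OF euclidean_bounded_incl_hconj])

section \<open>Orthonormal bases as sets of functionals\<close>

lemma fn_eq_0_iff: "fn x = (\<lambda>_. 0) \<longleftrightarrow> x = 0"
  using fn_inject[of x 0] by (simp add: fn_simps)

lemma hbar_eq_range: "hbar = range fn"
  using type_definition.Rep_range[OF type_definition_completion] by (rule sym)

lemma onb_image_fn: "onb (fn ` E) \<longleftrightarrow> completion.orthonormal_basis E"
  by (simp add: onb_def completion.orthonormal_basis_def completion.orthonormal_def
      hbar_eq_range inner_bar_fn fn_inject fn_eq_0_iff image_mono)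

lemma onb_iff: "onb F \<longleftrightarrow> (\<exists>E. completion.orthonormal_basis E \<and> F = fn ` E)"
proof
  assume F: "onb F"
  then have "F \<subseteq> range fn"
    by (simp add: onb_def hbar_eq_range)
  then obtain E where "F = fn ` E"
    by (auto simp: subset_image_iff)
  with F show "\<exists>E. completion.orthonormal_basis E \<and> F = fn ` E"
    by (auto simp: onb_image_fn)
qed (auto simp: onb_image_fn)

section \<open>Traces of squares\<close>

text \<open>For symmetric A the adjoint is the conjugate operator, so Hermitian means commuting with
  conjugation. Evaluation at \<open>hconj \<xi>\<close> undoes the conjugation inside
  \<open>conj_op\<close>.\<close>

lemma hermitian_op_hconj:
  assumes "symmetric_op A" "hermitian_op A"
  shows "hconj (A \<xi>) = A (hconj \<xi>)"
proof (rule bform_nondegenerate)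
  fix \<phi>
  have "adjoint_op A (emb \<phi>) (hconj \<xi>) = emb (A \<phi>) (hconj \<xi>)"
    using assms(2) by (simp add: hermitian_op_def)
  then have "bform \<phi> (hconj (A \<xi>)) = bform \<phi> (A (hconj \<xi>))"
    using assms(1) by (simp add: adjoint_op_def transpose_op_def conj_op_def emb_def hconj_hconj
        symmetric_op_def)
  then show "bform (hconj (A \<xi>)) \<phi> = bform (A (hconj \<xi>)) \<phi>"
    by (simp add: bform_sym)
qed

text \<open>Intended for the difference of two real symmetric operators. Boundedness is left to a
  separate locale because it has to be derived, from the trace class condition or from an explicit
  formula.\<close>

locale real_symmetric_op =
  fixes B :: "'h::euclidean_tvs \<Rightarrow> 'h"
  assumes B_add: "B (x + y) = B x + B y"
    and B_scaleC: "B (scaleC c x) = scaleC c (B x)"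
    and B_sym: "bform (B x) y = bform x (B y)"
    and B_hconj: "hconj (B x) = B (hconj x)"
begin

text \<open>\<open>trace_class\<close> bounds only the square, whereas the extension to the
  completion needs a bound on B itself. The absolute value covers a negative C.\<close>

lemma hnorm_bound_of_square:
  assumes "\<And>\<phi>. hnorm (B (B \<phi>)) \<le> C * hnorm \<phi>"
  shows "hnorm (B \<phi>) \<le> sqrt \<bar>C\<bar> * hnorm \<phi>"
proof (rule power2_le_imp_le)
  have "complex_of_real ((hnorm (B \<phi>))\<^sup>2) = bform (hconj \<phi>) (B (B \<phi>))"
    by (simp only: euclidean.cinner_self[symmetric] B_hconj B_sym)
  then have "(hnorm (B \<phi>))\<^sup>2 = cmod (bform (hconj \<phi>) (B (B \<phi>)))"
    by (metis norm_of_real abs_of_nonneg zero_le_power2)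
  also have "\<dots> \<le> hnorm \<phi> * hnorm (B (B \<phi>))"
    using norm_bform_le[of "hconj \<phi>"] by (simp add: hnorm_hconj)
  also have "\<dots> \<le> hnorm \<phi> * (\<bar>C\<bar> * hnorm \<phi>)"
    using assms[of \<phi>] mult_right_mono[OF abs_ge_self euclidean.cnorm_nonneg, of C \<phi>]
    by (intro mult_left_mono) auto
  finally show "(hnorm (B \<phi>))\<^sup>2 \<le> (sqrt \<bar>C\<bar> * hnorm \<phi>)\<^sup>2"
    by (simp add: power_mult_distrib power2_eq_square mult_ac)
qed simp

end

locale bounded_real_symmetric_op = real_symmetric_op B
  for B :: "'h::euclidean_tvs \<Rightarrow> 'h" +
  assumes B_bounded: "\<exists>C. \<forall>\<phi>. hnorm (B \<phi>) \<le> C * hnorm \<phi>"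
begin

definition ext :: "'h completion \<Rightarrow> 'h completion" where
  "ext = extend (\<lambda>\<phi>. incl (B \<phi>))"

lemma euclidean_bounded_B: "euclidean_bounded (\<lambda>\<phi>. incl (B \<phi>))"
  using B_bounded
  by (simp add: euclidean_bounded_def B_add B_scaleC incl_add incl_scaleR norm_incl)

lemma bounded_linear_ext: "bounded_linear ext"
  unfolding ext_def by (rule bounded_linear_extend[OF euclidean_bounded_B])

lemma ext_incl: "ext (incl \<phi>) = incl (B \<phi>)"
  unfolding ext_def by (rule extend_incl[OF euclidean_bounded_B])

text \<open>For symmetric B, extension by continuity and extension by transposition agree. This
  connects \<open>transpose_op\<close> with the operator on the Hilbert space.\<close>

lemma fn_ext: "fn (ext x) \<xi> = fn x (B \<xi>)"
  by (rule bounded_linear_eqI[where x=x])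
    (auto simp: ext_incl fn_incl_apply B_sym
      intro: bounded_linear_compose[OF bounded_linear_fn bounded_linear_ext] bounded_linear_fn)

lemma cform_ext: "cform (ext x) y = cform x (ext y)"
  by (rule bounded_linear_eqI[where x=x])
    (auto simp: ext_incl cform_incl_left fn_ext
      intro: bounded_linear_cform_left bounded_linear_compose[OF bounded_linear_cform_left bounded_linear_ext])

text \<open>Commutation with conjugation turns symmetry for the bilinear form into symmetry for the
  inner product.\<close>

lemma self_adjoint_ext: "completion.self_adjoint ext"
proof -
  have "cconj (ext x) = ext (cconj x)" for x
    by (rule fn_eqI) (simp add: fn_cconj fn_ext B_hconj)
  then show ?thesis
    by (simp add: completion.self_adjoint_def cinner_def cform_ext)
qed

lemma square_bounded: "\<exists>C. \<forall>\<phi>. hnorm ((B \<circ> B) \<phi>) \<le> C * hnorm \<phi>"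
proof -
  obtain C where C: "\<And>\<phi>. hnorm (B \<phi>) \<le> C * hnorm \<phi>"
    using B_bounded by blast
  have "hnorm (B (B \<phi>)) \<le> (\<bar>C\<bar> * \<bar>C\<bar>) * hnorm \<phi>" for \<phi>
  proof -
    have "hnorm (B (B \<phi>)) \<le> C * hnorm (B \<phi>)"
      by (rule C)
    also have "\<dots> \<le> \<bar>C\<bar> * hnorm (B \<phi>)"
      by (intro mult_right_mono) auto
    also have "hnorm (B \<phi>) \<le> \<bar>C\<bar> * hnorm \<phi>"
      using C[of \<phi>] mult_right_mono[OF abs_ge_self euclidean.cnorm_nonneg, of C \<phi>] by linarith
    finally show ?thesis
      by (simp add: mult_left_mono mult.assoc)
  qed
  then show ?thesis
    by auto
qed

lemma euclidean_bounded_square: "euclidean_bounded (\<lambda>\<phi>. incl ((B \<circ> B) \<phi>))"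
  using square_bounded
  by (simp add: euclidean_bounded_def B_add B_scaleC incl_add incl_scaleR norm_incl)

lemma map_bar_square: "map_bar (B \<circ> B) (fn x) = fn (ext (ext x))"
proof -
  have "extend (\<lambda>\<phi>. incl ((B \<circ> B) \<phi>)) x = ext (ext x)"
    by (rule bounded_linear_eqI[where x=x])
      (simp_all add: bounded_linear_extend[OF euclidean_bounded_square] extend_incl[OF euclidean_bounded_square]
        bounded_linear_compose[OF bounded_linear_ext bounded_linear_ext] ext_incl del: o_apply, simp)
  then show ?thesis
    by (simp only: map_bar_fn[OF euclidean_bounded_square])
qed

text \<open>By self-adjointness the diagonal entry <e, B B e> is |B e|^2, so the trace of the square
  is a squared Hilbert-Schmidt norm.\<close>

lemma inner_bar_square: "inner_bar (fn e) (map_bar (B \<circ> B) (fn e)) = complex_of_real ((norm (ext e))\<^sup>2)"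
  using self_adjoint_ext
  by (simp only: map_bar_square inner_bar_fn cinner_self_completion[symmetric] completion.self_adjoint_def)

lemma diagonal_square_has_sum_iff:
  "((\<lambda>e. inner_bar e (map_bar (B \<circ> B) e)) has_sum s) (fn ` E) \<longleftrightarrow>
   ((\<lambda>e. complex_of_real ((norm (ext e))\<^sup>2)) has_sum s) E"
proof -
  have inj: "inj_on fn E"
    by (simp add: inj_on_def fn_inject)
  have "(\<lambda>e. inner_bar e (map_bar (B \<circ> B) e)) \<circ> fn = (\<lambda>e. complex_of_real ((norm (ext e))\<^sup>2))"
    by (rule ext) (simp only: o_apply inner_bar_square)
  then show ?thesis
    by (simp only: has_sum_reindex[OF inj])
qed

text \<open>Every basis is controlled because \<open>trace_class\<close> quantifies over all of
  them; the one picked in \<open>hilbert_trace\<close> is among them.\<close>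

lemma trace_square_eqI:
  assumes "\<And>E. completion.orthonormal_basis E \<Longrightarrow> ((\<lambda>e. (norm (ext e))\<^sup>2) has_sum s) E"
  shows "trace_square B = ereal s"
proof -
  have sums: "((\<lambda>e. inner_bar e (map_bar (B \<circ> B) e)) has_sum complex_of_real s) E" if "onb E" for E
    using that assms by (auto simp: onb_iff diagonal_square_has_sum_iff has_sum_of_real_iff simp del: of_real_power)
  then have "trace_class (B \<circ> B)"
    using square_bounded by (auto simp: trace_class_def summable_on_def)
  moreover have "onb (SOME E :: ('h \<Rightarrow> complex) set. onb E)"
    using completion.orthonormal_basis_exists by (intro someI_ex[of onb]) (auto simp: onb_iff)
  then have "hilbert_trace (B \<circ> B) = complex_of_real s"
    unfolding hilbert_trace_def Let_def by (intro infsumI sums)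
  ultimately show ?thesis
    by (simp add: trace_square_def)
qed

text \<open>In the finite case E is the preimage of the very basis picked in
  \<open>hilbert_trace\<close>, so no comparison of bases arises.\<close>

lemma trace_square_cases:
  obtains "trace_square B = \<infinity>"
    | E s where "completion.orthonormal_basis E" "((\<lambda>e. (norm (ext e))\<^sup>2) has_sum s) E"
        "trace_square B = ereal s"
proof (cases "trace_class (B \<circ> B)")
  case True
  define F where "F = (SOME E :: ('h \<Rightarrow> complex) set. onb E)"
  have F: "onb F"
    unfolding F_def using completion.orthonormal_basis_exists
    by (intro someI_ex[of onb]) (auto simp: onb_iff)
  then obtain E where E: "completion.orthonormal_basis E" "F = fn ` E"
    by (auto simp: onb_iff)
  define s where "s = Re (hilbert_trace (B \<circ> B))"
  have "(\<lambda>e. inner_bar e (map_bar (B \<circ> B) e)) summable_on F"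
    using True F by (simp add: trace_class_def)
  then have "((\<lambda>e. inner_bar e (map_bar (B \<circ> B) e)) has_sum hilbert_trace (B \<circ> B)) F"
    unfolding hilbert_trace_def Let_def F_def[symmetric] by (rule has_sum_infsum)
  then have "((\<lambda>e. complex_of_real ((norm (ext e))\<^sup>2)) has_sum hilbert_trace (B \<circ> B)) E"
    unfolding E(2) diagonal_square_has_sum_iff .
  then have "((\<lambda>e. (norm (ext e))\<^sup>2) has_sum s) E"
    using has_sum_bounded_linear[OF bounded_linear_Re] unfolding s_def by fastforce
  then show ?thesis
    using that(2) E(1) True by (simp add: trace_square_def s_def)
next
  case False
  then show ?thesis
    using that(1) by (simp add: trace_square_def)
qed

end

context real_symmetric_op
begin

text \<open>The vector v is B u in the sense of functionals, which is meaningful before B is known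
  to be bounded. The corner part depends on its operator only through the value at u, so the
  constant map v defines K.\<close>

lemma trace_square_corner:
  fixes u v :: "'h completion"
  assumes u: "norm u = 1" and v: "fn v = transpose_op B (fn u)"
  defines "K \<equiv> completion.corner_part (\<lambda>_. v) u"
    and "t \<equiv> 2 * (norm v)\<^sup>2 - (Re (cinner u v))\<^sup>2"
  shows "trace_square B \<ge> ereal t"
    and "trace_square B = ereal t \<longleftrightarrow> (\<forall>\<phi>. incl (B \<phi>) = K (incl \<phi>))"
proof -
  \<comment> \<open>Boundedness is a premise here, since it arises differently in the two directions
    below.\<close>
  have split: "((\<lambda>e. (norm (bounded_real_symmetric_op.ext B e))\<^sup>2
        - (norm (bounded_real_symmetric_op.ext B e - K e))\<^sup>2) has_sum t) E"
    and adj: "completion.self_adjoint (\<lambda>x. bounded_real_symmetric_op.ext B x - K x)"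
    if "\<exists>C. \<forall>\<phi>. hnorm (B \<phi>) \<le> C * hnorm \<phi>" "completion.orthonormal_basis E" for E
  proof -
    interpret bounded_real_symmetric_op B
      by unfold_locales (fact that(1))
    have "ext u = v"
      by (rule fn_eqI) (simp add: fn_ext v transpose_op_def)
    then have K: "K = completion.corner_part ext u" and t: "t = 2 * (norm (ext u))\<^sup>2 - (Re (cinner u (ext u)))\<^sup>2"
      by (auto simp: K_def t_def completion.corner_part_def)
    show "((\<lambda>e. (norm (ext e))\<^sup>2 - (norm (ext e - K e))\<^sup>2) has_sum t) E"
      unfolding K t by (rule completion.Hilbert_Schmidt_split[OF self_adjoint_ext u that(2)])
    show "completion.self_adjoint (\<lambda>x. ext x - K x)"
      unfolding K by (intro completion.self_adjoint_diff completion.self_adjoint_corner_part self_adjoint_ext)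
  qed
  have lower: "trace_square B \<ge> ereal t \<and> (trace_square B = ereal t \<longrightarrow> (\<forall>\<phi>. incl (B \<phi>) = K (incl \<phi>)))"
  proof (cases "trace_class (B \<circ> B)")
    case True
    then obtain C where "\<And>\<phi>. hnorm (B (B \<phi>)) \<le> C * hnorm \<phi>"
      by (auto simp: trace_class_def)
    then have bounded: "\<exists>C. \<forall>\<phi>. hnorm (B \<phi>) \<le> C * hnorm \<phi>"
      using hnorm_bound_of_square by blast
    interpret bounded_real_symmetric_op B
      by unfold_locales (fact bounded)
    show ?thesis
    proof (cases rule: trace_square_cases)
      case 1
      then show ?thesis
        by simp
    next
      case (2 E s)
      \<comment> \<open>Subtracting the split from the trace leaves the squared norms of the
        remainder, which therefore sum to s - t.\<close>
      have R: "((\<lambda>e. (norm (ext e - K e))\<^sup>2) has_sum s - t) E"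
        using has_sum_add[OF 2(2) has_sum_uminusI[OF split[OF bounded 2(1)]]] by simp
      then have "t \<le> s"
        using has_sum_nonneg[OF R] by simp
      moreover have "incl (B \<phi>) = K (incl \<phi>)" if "s = t" for \<phi>
      proof -
        \<comment> \<open>When s = t, nonnegative terms with zero sum all vanish; the self-adjoint
          remainder is then zero on a basis, hence everywhere.\<close>
        have "ext e - K e = 0" if "e \<in> E" for e
          using nonneg_has_sum_le_0D[OF R _ _ that] \<open>s = t\<close> by simp
        then have "ext (incl \<phi>) - K (incl \<phi>) = 0"
          by (rule completion.zero_on_orthonormal_basis[OF 2(1) adj[OF bounded 2(1)]])
        then show ?thesis
          by (simp add: ext_incl)
      qed
      ultimately show ?thesis
        by (simp add: 2(3))
    qed
  qed (simp add: trace_square_def)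
  \<comment> \<open>Conversely, agreement with K on embedded vectors bounds B and makes its
    extension equal to K, so the remainder vanishes in every basis.\<close>
  have "trace_square B = ereal t" if BK: "\<And>\<phi>. incl (B \<phi>) = K (incl \<phi>)"
  proof -
    have "hnorm (B \<phi>) \<le> (3 * norm v) * hnorm \<phi>" for \<phi>
      using completion.norm_corner_part_le[OF u, of "\<lambda>_. v" "incl \<phi>"]
      by (simp add: BK[unfolded K_def, symmetric] norm_incl)
    then have bounded: "\<exists>C. \<forall>\<phi>. hnorm (B \<phi>) \<le> C * hnorm \<phi>"
      by blast
    interpret bounded_real_symmetric_op B
      by unfold_locales (fact bounded)
    have "ext x = K x" for x
      by (rule bounded_linear_eqI[OF bounded_linear_ext])
        (simp_all add: ext_incl BK K_def completion.bounded_linear_corner_part)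
    then show ?thesis
      using split[OF bounded] by (intro trace_square_eqI) simp
  qed
  with lower show "trace_square B \<ge> ereal t"
    and "trace_square B = ereal t \<longleftrightarrow> (\<forall>\<phi>. incl (B \<phi>) = K (incl \<phi>))"
    by blast+
qed

end

section \<open>The corner estimate and Cauchy-Schwarz applied to the given vector\<close>

theorem theorem8p2:
  fixes L :: "'h::euclidean_tvs \<Rightarrow> 'h" and \<psi> :: "'h \<Rightarrow> complex"
  assumes "L \<in> Lin" and "symmetric_op L" and "hermitian_op L"
    and "\<psi> \<in> hbar" and "\<psi> \<noteq> (\<lambda>_. 0)" and "hconj_bar \<psi> = \<psi>"
    and "transpose_op L \<psi> \<in> hbar"
  shows "(\<forall>Lt\<in>Lin. symmetric_op Lt \<and> hermitian_op Lt \<and> transpose_op Lt \<psi> = (\<lambda>_. 0) \<longrightarrow>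
             trace_square (\<lambda>\<phi>. Lt \<phi> - L \<phi>) \<ge> ereal (Re (tau L \<psi>)) \<and>
             (trace_square (\<lambda>\<phi>. Lt \<phi> - L \<phi>) = ereal (Re (tau L \<psi>)) \<longleftrightarrow>
               (\<forall>\<phi>. emb (Lt \<phi>) = L_hat L \<psi> \<phi>))) \<and>
         0 \<le> bform_bar (transpose_op L \<psi>) (transpose_op L \<psi>) / bform_bar \<psi> \<psi> \<and>
         bform_bar (transpose_op L \<psi>) (transpose_op L \<psi>) / bform_bar \<psi> \<psi> \<le> tau L \<psi> \<and>
         tau L \<psi> \<le> 2 * (bform_bar (transpose_op L \<psi>) (transpose_op L \<psi>) / bform_bar \<psi> \<psi>) \<and>
         (tau L \<psi> = 0 \<longleftrightarrow> transpose_op L \<psi> = (\<lambda>_. 0))"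
proof -
  obtain x y where x: "\<psi> = fn x" and y: "transpose_op L \<psi> = fn y"
    using assms(4,7) by (auto simp: hbar_eq_range)
  have y_apply: "fn y \<xi> = fn x (L \<xi>)" for \<xi>
    using y by (simp add: x transpose_op_def fun_eq_iff)
  have "x \<noteq> 0"
    using assms(5) by (auto simp: x fn_eq_0_iff)
  define n where "n = norm x"
  have n: "n > 0"
    using \<open>x \<noteq> 0\<close> by (simp add: n_def)
  have conj_x: "cconj x = x"
    using assms(6) by (simp add: x hconj_bar_fn fn_inject)
  \<comment> \<open>L commutes with conjugation, so its value y at the real vector x is real too.
    The bilinear form and the inner product thus agree when the first argument is x or y.\<close>
  have conj_y: "cconj y = y"
  proof (rule fn_eqI)
    fix \<xi>
    have "fn x (hconj (L \<xi>)) = cnj (fn x (L \<xi>))"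
      using fn_cconj[of x "L \<xi>"] by (metis conj_x complex_cnj_cnj)
    then show "fn (cconj y) \<xi> = fn y \<xi>"
      by (simp add: fn_cconj y_apply flip: hermitian_op_hconj[OF assms(2,3)])
  qed
  have cform_x: "cform x z = cinner x z" and cform_y: "cform y z = cinner y z" for z
    by (simp_all add: cinner_def conj_x conj_y)
  define a where "a = Re (cinner x y)"
  have "cnj (cinner x y) = cinner x y"
    using cform_cconj[of x y] by (simp add: conj_x conj_y cform_x)
  then have xy: "cinner x y = complex_of_real a"
    by (simp add: a_def complex_eq_iff)
  define q where "q = (norm y)\<^sup>2 / n\<^sup>2"
  have quotient: "bform_bar (fn y) (fn y) / bform_bar (fn x) (fn x) = complex_of_real q"
    by (simp add: bform_bar_fn cform_x cform_y cinner_self_completion q_def n_def)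
  have tau: "tau L \<psi> = complex_of_real (2 * q - (a / n\<^sup>2)\<^sup>2)"
    unfolding tau_def y unfolding x quotient
    by (simp add: bform_bar_fn cform_x cinner_self_completion xy n_def)
  have "0 \<le> q"
    by (simp add: q_def)
  \<comment> \<open>This Cauchy-Schwarz estimate carries part (ii), since tau is 2 q - (a /
    n^2)^2.\<close>
  have a_le: "(a / n\<^sup>2)\<^sup>2 \<le> q"
  proof -
    have "\<bar>a\<bar> \<le> n * norm y"
      using completion.norm_cinner_le[of x y] by (simp add: xy n_def)
    then have "a\<^sup>2 \<le> (n * norm y)\<^sup>2"
      by (metis abs_le_square_iff abs_of_nonneg mult_nonneg_nonneg n_def norm_ge_zero)
    then show ?thesis
      using n by (simp add: q_def field_simps power_mult_distrib power2_eq_square)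
  qed
  have "2 * q - (a / n\<^sup>2)\<^sup>2 = 0 \<longleftrightarrow> y = 0"
  proof
    assume "2 * q - (a / n\<^sup>2)\<^sup>2 = 0"
    then have "q = 0"
      using a_le \<open>0 \<le> q\<close> by linarith
    then show "y = 0"
      using n by (simp add: q_def)
  next
    assume "y = 0"
    then have "q = 0"
      by (simp add: q_def)
    then show "2 * q - (a / n\<^sup>2)\<^sup>2 = 0"
      using a_le by simp
  qed
  then have tau_zero: "tau L \<psi> = 0 \<longleftrightarrow> transpose_op L \<psi> = (\<lambda>_. 0)"
    unfolding tau y fn_eq_0_iff of_real_eq_0_iff .
  \<comment> \<open>u is the normalised x. Since Lt annihilates x, the difference Lt - L sends u to
    - y / n, so v is the same for every admissible Lt.\<close>
  define u v where "u = cscale (of_real (1 / n)) x" and "v = cscale (of_real (- 1 / n)) y"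
  define K where "K = completion.corner_part (\<lambda>_. v) u"
  have u: "norm u = 1"
    using n by (simp add: u_def completion.norm_cscale n_def norm_divide)
  have bound: "2 * (norm v)\<^sup>2 - (Re (cinner u v))\<^sup>2 = Re (tau L \<psi>)"
    unfolding tau using n
    by (simp add: u_def v_def completion.norm_cscale completion.cinner_cscale_left
        completion.cinner_cscale_right xy q_def norm_divide power_divide power2_eq_square)
  have part_i: "trace_square (\<lambda>\<phi>. Lt \<phi> - L \<phi>) \<ge> ereal (Re (tau L \<psi>)) \<and>
      (trace_square (\<lambda>\<phi>. Lt \<phi> - L \<phi>) = ereal (Re (tau L \<psi>)) \<longleftrightarrow>
        (\<forall>\<phi>. emb (Lt \<phi>) = L_hat L \<psi> \<phi>))"
    if Lt: "Lt \<in> Lin" "symmetric_op Lt" "hermitian_op Lt" "transpose_op Lt \<psi> = (\<lambda>_. 0)" for Lt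
  proof -
    interpret real_symmetric_op "\<lambda>\<phi>. Lt \<phi> - L \<phi>"
    proof
      fix x y :: 'h and c
      show "Lt (x + y) - L (x + y) = Lt x - L x + (Lt y - L y)"
        using assms(1) Lt(1) by (simp add: Lin_iff)
      show "Lt (scaleC c x) - L (scaleC c x) = scaleC c (Lt x - L x)"
        using assms(1) Lt(1) by (simp add: Lin_iff scaleC.scale_right_diff_distrib)
      show "bform (Lt x - L x) y = bform x (Lt y - L y)"
        using assms(2) Lt(2) bform_diff[of "Lt y" "L y" x]
        by (simp add: bform_diff symmetric_op_def bform_sym[of x])
      show "hconj (Lt x - L x) = Lt (hconj x) - L (hconj x)"
        by (simp add: hconj_diff hermitian_op_hconj assms Lt)
    qed
    have Lt_x: "fn x (Lt \<xi>) = 0" for \<xi>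
      using Lt(4) by (simp add: transpose_op_def x fun_eq_iff)
    have "fn v = transpose_op (\<lambda>\<phi>. Lt \<phi> - L \<phi>) (fn u)"
      using euclidean_dual_diff[OF fn_euclidean_dual[of x]]
      by (intro ext) (simp add: v_def u_def fn_cscale transpose_op_def y_apply Lt_x)
    note corner = trace_square_corner[OF u this, folded K_def, unfolded bound]
    \<comment> \<open>The equality case is translated by L_hat = L + K, read as maps from the
      original space into the completion.\<close>
    have "incl (Lt \<phi> - L \<phi>) = K (incl \<phi>) \<longleftrightarrow> emb (Lt \<phi>) = L_hat L \<psi> \<phi>" for \<phi>
    proof -
      have proj: "proj_compl \<psi> (fn z) = fn (z - cscale (cinner x z / of_real (n\<^sup>2)) x)" for z
        by (rule ext) (simp add: proj_compl_def rank_one_def x bform_bar_fn fn_simps fn_cscale cform_x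
            cinner_self_completion n_def)
      \<comment> \<open>c is the coefficient of x removed by the inner projection. The transpose of
        L then sends the embedded vector to its image under L by symmetry, and x to y.\<close>
      define c where "c = cinner x (incl \<phi>) / of_real (n\<^sup>2)"
      have transpose: "transpose_op L (fn (incl \<phi> - cscale c x)) = fn (incl (L \<phi>) - cscale c y)"
        using assms(2) by (simp add: transpose_op_def fn_simps fn_cscale fn_incl_apply y_apply
            symmetric_op_def)
      have "L_hat L \<psi> \<phi> = fn (incl (L \<phi>) - cscale c y
          - cscale (cinner x (incl (L \<phi>) - cscale c y) / of_real (n\<^sup>2)) x)"
        by (simp only: L_hat_def fn_incl[symmetric] proj transpose flip: c_def)
      also have "incl (L \<phi>) - cscale c y - cscale (cinner x (incl (L \<phi>) - cscale c y) / of_real (n\<^sup>2)) x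
          = incl (L \<phi>) + K (incl \<phi>)"
      proof (rule fn_eqI)
        fix \<xi>
        \<comment> \<open>This is the transposition rule for L, written with the inner product
          because x and y are real.\<close>
        have "cinner y (incl \<phi>) = cinner x (incl (L \<phi>))"
          by (simp flip: cform_x cform_y add: cform_incl_right y_apply)
        then show "fn (incl (L \<phi>) - cscale c y
            - cscale (cinner x (incl (L \<phi>) - cscale c y) / of_real (n\<^sup>2)) x) \<xi>
          = fn (incl (L \<phi>) + K (incl \<phi>)) \<xi>"
          using n by (simp add: K_def completion.corner_part_def u_def v_def fn_simps fn_cscale
              completion.cinner_simps xy c_def power2_eq_square field_simps)
      qed
      finally show ?thesis
        by (simp add: fn_inject incl_diff diff_eq_eq add.commute flip: fn_incl)
    qed
    with corner show ?thesis
      by blast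
  qed
  \<comment> \<open>All quantities of part (ii) are images of reals, so the complex order, which
    demands equal imaginary parts, reduces to the order of the reals.\<close>
  show ?thesis
    unfolding y unfolding x quotient tau[unfolded x]
    using part_i tau_zero \<open>0 \<le> q\<close> a_le unfolding y unfolding x tau[unfolded x]
    by (simp add: less_eq_complex_def del: of_real_diff)
qed

end
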